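(* If $S$ is a connected partial braid graph with at least one exterior edge, then there is an isomorphism of $\mathcal{R}$-modules $$\mathrm{Tor}^{\mathcal{R}}_0(\mathcal{R}/L_S,\mathcal{R}/N_S)\cong\mathrm{Tor}^{\mathcal{R}}_0(\mathcal{R}/L_S,\mathcal{R}/Q_S).$$ In fact, for any connected partial braid graph $S$, we have $L_S+N_S=L_S+Q_S$ as ideals in $\mathcal{R}$.
   Context: Open partial braid graphs. An open partial braid graph $\Gamma$ consists of a finite collection of smooth arcs $\gamma_1,\dots,\gamma_r:[0,1]\to D=[0,1]\times[0,1]$ and a finite set of vertices $W=\{p_1,\dots,p_m\}$ such that: (1) for each $i$, the second coordinate of $\gamma_i$ has strictly positive derivative on $[0,1]$; (2) each $p_j$ lies in the interior of one or two of the arcs; (3) any two arcs intersect transversely and only in their interiors, and every intersection point of two arcs is a vertex in $W$; (4) no three arcs have a common point; (5) the number $k$ of arcs with initial point on $[0,1]\times\{0\}$ equals the number of arcs with final point on $[0,1]\times\{1\}$. Partial braid graphs. A partial braid graph $S=\hat\Gamma$ is the braid closure of an open partial braid graph $\Gamma$: the arc endpoints on $[0,1]\times\{1\}$ are joined to the arc endpoints on $[0,1]\times\{0\}$ by $k$ disjoint nested strands running to the right of $D$ (the $i$-th from the left on top is joined to the $i$-th from the left on the bottom), and these endpoints are then no longer regarded as vertices. The remaining arc endpoints are called loose ends (they are not elements of $W$). The vertices of $S$ are the elements of $W$; each is four-valent (where two arcs cross) or two-valent (interior point of a single arc). The edges of $S$ are the connected components of $S\setminus W$, oriented by the upward orientation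 of the arcs; an edge having a loose end is called exterior. $S$ is connected if it is connected as a graph. Ideals. Let $E$ be the set of edges of $S$ and $\mathcal{R}=\mathbb{Z}[U_e : e\in E]$. For a four-valent vertex $p$ with outgoing edges $a,b$ and incoming edges $c,d$, put $L(p)=U_a+U_b-U_c-U_d$ and $Q(p)=U_aU_b-U_cU_d$. For a two-valent vertex $p$ with outgoing edge $e$ and incoming edge $f$, put $Q(p)=U_e-U_f$. $L_S$ is the ideal generated by $L(p)$ over all four-valent vertices $p$. $Q_S$ is the ideal generated by $Q(p)$ over all $p\in W$. For a subset $W'\subseteq W$, let $\mathrm{in}(W')$ (resp. $\mathrm{out}(W')$) be the set of edges that are incoming (resp. outgoing) at some vertex of $W'$, and put $\mathrm{In}(W')=\mathrm{in}(W')\setminus\mathrm{out}(W')$, $\mathrm{Out}(W')=\mathrm{out}(W')\setminus\mathrm{in}(W')$, and $N(W')=\prod_{e\in\mathrm{Out}(W')}U_e-\prod_{e\in\mathrm{In}(W')}U_e$. $N_S$ is the ideal generated by $N(W')$ over all subsets $W'\subseteq W$. *)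

theory Defs
  imports
    "HOL-Analysis.Analysis"
    "HOL-Library.Poly_Mapping"
    "HOL-Algebra.Ideal"
    "HOL-Algebra.Module"
begin

section \<open>Partial braid graphs\<close>

type_synonym plane = "real \<times> real"

record open_braid_graph =
  num_arcs :: nat
  arc_of :: "nat \<Rightarrow> real \<Rightarrow> plane"
  verts :: "plane set"

record braid_graph = open_braid_graph +
  strand_of :: "nat \<Rightarrow> real \<Rightarrow> plane"

abbreviation velocity :: "(real \<Rightarrow> plane) \<Rightarrow> real \<Rightarrow> plane" where
  "velocity g t \<equiv> vector_derivative g (at t within {0..1})"

text \<open>Derivatives of all orders exist on the closed interval (one-sided at the endpoints).\<close>

definition smooth_arc :: "(real \<Rightarrow> plane) \<Rightarrow> bool" where
  "smooth_arc g \<longleftrightarrow> (\<forall>n. (velocity ^^ n) g differentiable_on {0..1})"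

definition arcs_through :: "'a open_braid_graph_scheme \<Rightarrow> plane \<Rightarrow> nat set" where
  "arcs_through G p = {i. i < num_arcs G \<and> p \<in> arc_of G i ` {0<..<1}}"

definition bottom_arcs :: "'a open_braid_graph_scheme \<Rightarrow> nat set" where
  "bottom_arcs G = {i. i < num_arcs G \<and> arc_of G i 0 \<in> {0..1} \<times> {0}}"

definition top_arcs :: "'a open_braid_graph_scheme \<Rightarrow> nat set" where
  "top_arcs G = {i. i < num_arcs G \<and> arc_of G i 1 \<in> {0..1} \<times> {1}}"

definition open_partial_braid_graph :: "'a open_braid_graph_scheme \<Rightarrow> bool" where
  "open_partial_braid_graph G \<longleftrightarrow>
     (\<forall>i<num_arcs G. smooth_arc (arc_of G i) \<and> arc_of G i ` {0..1} \<subseteq> {0..1} \<times> {0..1}) \<and>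
     finite (verts G) \<and>
     (\<forall>i<num_arcs G. \<forall>t\<in>{0..1}. 0 < snd (velocity (arc_of G i) t)) \<and>
     (\<forall>p\<in>verts G. card (arcs_through G p) \<in> {1, 2}) \<and>
     (\<forall>i<num_arcs G. \<forall>j<num_arcs G. \<forall>s\<in>{0..1}. \<forall>t\<in>{0..1}.
        i \<noteq> j \<longrightarrow> arc_of G i s = arc_of G j t \<longrightarrow>
          s \<in> {0<..<1} \<and> t \<in> {0<..<1} \<and>
          span {velocity (arc_of G i) s, velocity (arc_of G j) t} = UNIV \<and>
          arc_of G i s \<in> verts G) \<and>
     (\<forall>i<num_arcs G. \<forall>j<num_arcs G. \<forall>k<num_arcs G. i \<noteq> j \<longrightarrow> j \<noteq> k \<longrightarrow> i \<noteq> k \<longrightarrow>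
        arc_of G i ` {0..1} \<inter> arc_of G j ` {0..1} \<inter> arc_of G k ` {0..1} = {}) \<and>
     card (bottom_arcs G) = card (top_arcs G)"

text \<open>First coordinates of the endpoints on the bottom and top side, from left to right.
  (Distinct arcs have distinct endpoints, so no endpoint is lost in these lists.)\<close>

definition bottom_points :: "'a open_braid_graph_scheme \<Rightarrow> real list" where
  "bottom_points G = sorted_list_of_set ((\<lambda>i. fst (arc_of G i 0)) ` bottom_arcs G)"

definition top_points :: "'a open_braid_graph_scheme \<Rightarrow> real list" where
  "top_points G = sorted_list_of_set ((\<lambda>i. fst (arc_of G i 1)) ` top_arcs G)"

text \<open>The closing strands, numbered from \<open>0\<close>, are disjoint simple arcs which avoid the square
  and the half-strip to its left, so that they pass on its right; as the \<open>i\<close>-th top point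
  is joined to the \<open>i\<close>-th bottom point, disjointness makes them nested.  Every choice of such
  strands is admitted.\<close>

definition partial_braid_graph :: "braid_graph \<Rightarrow> bool" where
  "partial_braid_graph S \<longleftrightarrow>
     open_partial_braid_graph S \<and>
     (\<forall>i<card (bottom_arcs S).
        arc (strand_of S i) \<and>
        pathstart (strand_of S i) = (top_points S ! i, 1) \<and>
        pathfinish (strand_of S i) = (bottom_points S ! i, 0) \<and>
        strand_of S i ` {0<..<1} \<inter> ({..1} \<times> {0..1}) = {}) \<and>
     (\<forall>i<card (bottom_arcs S). \<forall>j<card (bottom_arcs S). i \<noteq> j \<longrightarrow>
        path_image (strand_of S i) \<inter> path_image (strand_of S j) = {})"

definition space_of :: "braid_graph \<Rightarrow> plane set" where
  "space_of S = (\<Union>i<num_arcs S. arc_of S i ` {0..1}) \<union>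
                (\<Union>i<card (bottom_arcs S). path_image (strand_of S i))"

definition loose_ends :: "'a open_braid_graph_scheme \<Rightarrow> plane set" where
  "loose_ends S = {arc_of S i 0 | i. i < num_arcs S \<and> i \<notin> bottom_arcs S} \<union>
                  {arc_of S i 1 | i. i < num_arcs S \<and> i \<notin> top_arcs S}"

definition edges :: "braid_graph \<Rightarrow> plane set set" where
  "edges S = components (space_of S - verts S)"

definition exterior_edge :: "braid_graph \<Rightarrow> plane set \<Rightarrow> bool" where
  "exterior_edge S e \<longleftrightarrow> e \<in> edges S \<and> e \<inter> loose_ends S \<noteq> {}"

definition four_valent :: "'a open_braid_graph_scheme \<Rightarrow> plane \<Rightarrow> bool" where
  "four_valent S p \<longleftrightarrow> p \<in> verts S \<and> card (arcs_through S p) = 2"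

text \<open>An edge leaves (enters) a vertex \<open>p\<close> if it contains the part of some arc through \<open>p\<close>
  just above (below) \<open>p\<close>.\<close>

definition out_edges :: "braid_graph \<Rightarrow> plane \<Rightarrow> plane set set" where
  "out_edges S p = {e \<in> edges S. \<exists>i<num_arcs S. \<exists>s\<in>{0<..<1}.
     arc_of S i s = p \<and> (\<forall>\<^sub>F t in at_right s. arc_of S i t \<in> e)}"

definition in_edges :: "braid_graph \<Rightarrow> plane \<Rightarrow> plane set set" where
  "in_edges S p = {e \<in> edges S. \<exists>i<num_arcs S. \<exists>s\<in>{0<..<1}.
     arc_of S i s = p \<and> (\<forall>\<^sub>F t in at_left s. arc_of S i t \<in> e)}"

section \<open>The edge ring and its ideals\<close>

text \<open>A polynomial is a finitely supported map from monomials to integer coefficients, a monomial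
  being a finitely supported map from variables to exponents.\<close>

type_synonym 'v int_poly = "('v \<Rightarrow>\<^sub>0 nat) \<Rightarrow>\<^sub>0 int"

definition int_poly_ring :: "'v set \<Rightarrow> 'v int_poly ring" where
  "int_poly_ring V = \<lparr>carrier = {f. \<forall>m\<in>Poly_Mapping.keys f. Poly_Mapping.keys m \<subseteq> V},
     mult = (*), one = 1, zero = 0, add = (+)\<rparr>"

definition var :: "'v \<Rightarrow> 'v int_poly" where
  "var e = Poly_Mapping.single (Poly_Mapping.single e 1) 1"

definition edge_ring :: "braid_graph \<Rightarrow> plane set int_poly ring" where
  "edge_ring S = int_poly_ring (edges S)"

definition L_gen :: "braid_graph \<Rightarrow> plane \<Rightarrow> plane set int_poly" where
  "L_gen S p = (\<Sum>e\<in>out_edges S p. var e) - (\<Sum>e\<in>in_edges S p. var e)"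

text \<open>A two-valent vertex has one outgoing and one incoming edge, a four-valent vertex has two
  distinct ones of each kind; the products below cover both definitions of \<open>Q(p)\<close>.\<close>

definition Q_gen :: "braid_graph \<Rightarrow> plane \<Rightarrow> plane set int_poly" where
  "Q_gen S p = (\<Prod>e\<in>out_edges S p. var e) - (\<Prod>e\<in>in_edges S p. var e)"

definition N_gen :: "braid_graph \<Rightarrow> plane set \<Rightarrow> plane set int_poly" where
  "N_gen S W =
     (\<Prod>e\<in>\<Union>(out_edges S ` W) - \<Union>(in_edges S ` W). var e) -
     (\<Prod>e\<in>\<Union>(in_edges S ` W) - \<Union>(out_edges S ` W). var e)"

definition L_ideal :: "braid_graph \<Rightarrow> plane set int_poly set" where
  "L_ideal S = genideal (edge_ring S) {L_gen S p | p. four_valent S p}"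

definition Q_ideal :: "braid_graph \<Rightarrow> plane set int_poly set" where
  "Q_ideal S = genideal (edge_ring S) {Q_gen S p | p. p \<in> verts S}"

definition N_ideal :: "braid_graph \<Rightarrow> plane set int_poly set" where
  "N_ideal S = genideal (edge_ring S) {N_gen S W | W. W \<subseteq> verts S}"

section \<open>Tor\<close>

definition module_hom :: "'r ring \<Rightarrow> ('r, 'a) module \<Rightarrow> ('r, 'b) module \<Rightarrow> ('a \<Rightarrow> 'b) set" where
  "module_hom R M N = {h \<in> carrier M \<rightarrow> carrier N.
     (\<forall>x\<in>carrier M. \<forall>y\<in>carrier M. h (x \<oplus>\<^bsub>M\<^esub> y) = h x \<oplus>\<^bsub>N\<^esub> h y) \<and>
     (\<forall>a\<in>carrier R. \<forall>x\<in>carrier M. h (a \<odot>\<^bsub>M\<^esub> x) = a \<odot>\<^bsub>N\<^esub> h x)}"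

definition module_isomorphic :: "'r ring \<Rightarrow> ('r, 'a) module \<Rightarrow> ('r, 'b) module \<Rightarrow> bool" where
  "module_isomorphic R M N \<longleftrightarrow> (\<exists>h\<in>module_hom R M N. bij_betw h (carrier M) (carrier N))"

definition hom_kernel :: "('r, 'a) module \<Rightarrow> ('r, 'b) module \<Rightarrow> ('a \<Rightarrow> 'b) \<Rightarrow> 'a set" where
  "hom_kernel M N h = {x \<in> carrier M. h x = \<zero>\<^bsub>N\<^esub>}"

text \<open>The fields \<open>mult\<close> and \<open>one\<close> of the type of modules carry no meaning for modules.\<close>

definition regular_module :: "'r ring \<Rightarrow> ('r, 'r) module" where
  "regular_module R = \<lparr>carrier = carrier R, mult = undefined, one = undefined,
     zero = \<zero>\<^bsub>R\<^esub>, add = add R, smult = mult R\<rparr>"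

definition quotient_module :: "('r, 'a) module \<Rightarrow> 'a set \<Rightarrow> ('r, 'a set) module" where
  "quotient_module M H = \<lparr>carrier = a_rcosets\<^bsub>M\<^esub> H, mult = undefined, one = undefined,
     zero = H, add = set_add M, smult = (\<lambda>a X. \<Union>x\<in>X. H +>\<^bsub>M\<^esub> (a \<odot>\<^bsub>M\<^esub> x))\<rparr>"

definition generated_submodule :: "'r ring \<Rightarrow> ('r, 'a) module \<Rightarrow> 'a set \<Rightarrow> 'a set" where
  "generated_submodule R M X = \<Inter>{H. submodule H R M \<and> X \<subseteq> H}"

definition free_module :: "'r ring \<Rightarrow> 'x set \<Rightarrow> ('r, 'x \<Rightarrow> 'r) module" where
  "free_module R X = \<lparr>carrier = {f. range f \<subseteq> carrier R \<and> finite {x. f x \<noteq> \<zero>\<^bsub>R\<^esub>} \<and>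
                                    {x. f x \<noteq> \<zero>\<^bsub>R\<^esub>} \<subseteq> X},
     mult = undefined, one = undefined, zero = (\<lambda>_. \<zero>\<^bsub>R\<^esub>),
     add = (\<lambda>f g x. f x \<oplus>\<^bsub>R\<^esub> g x), smult = (\<lambda>a f x. a \<otimes>\<^bsub>R\<^esub> f x)\<rparr>"

definition free_gen :: "'r ring \<Rightarrow> 'x \<Rightarrow> 'x \<Rightarrow> 'r" where
  "free_gen R x = (\<lambda>y. if y = x then \<one>\<^bsub>R\<^esub> else \<zero>\<^bsub>R\<^esub>)"

subsection \<open>Tensor products\<close>

definition tensor_relations ::
    "'r ring \<Rightarrow> ('r, 'a) module \<Rightarrow> ('r, 'b) module \<Rightarrow> ('a \<times> 'b \<Rightarrow> 'r) set" where
  "tensor_relations R M N =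
    (let F = free_module R (carrier M \<times> carrier N); g = free_gen R in
      {g (x \<oplus>\<^bsub>M\<^esub> x', y) \<ominus>\<^bsub>F\<^esub> (g (x, y) \<oplus>\<^bsub>F\<^esub> g (x', y)) | x x' y.
         x \<in> carrier M \<and> x' \<in> carrier M \<and> y \<in> carrier N} \<union>
      {g (x, y \<oplus>\<^bsub>N\<^esub> y') \<ominus>\<^bsub>F\<^esub> (g (x, y) \<oplus>\<^bsub>F\<^esub> g (x, y')) | x y y'.
         x \<in> carrier M \<and> y \<in> carrier N \<and> y' \<in> carrier N} \<union>
      {g (a \<odot>\<^bsub>M\<^esub> x, y) \<ominus>\<^bsub>F\<^esub> (a \<odot>\<^bsub>F\<^esub> g (x, y)) | a x y.
         a \<in> carrier R \<and> x \<in> carrier M \<and> y \<in> carrier N} \<union>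
      {g (x, a \<odot>\<^bsub>N\<^esub> y) \<ominus>\<^bsub>F\<^esub> (a \<odot>\<^bsub>F\<^esub> g (x, y)) | a x y.
         a \<in> carrier R \<and> x \<in> carrier M \<and> y \<in> carrier N})"

definition tensor_null ::
    "'r ring \<Rightarrow> ('r, 'a) module \<Rightarrow> ('r, 'b) module \<Rightarrow> ('a \<times> 'b \<Rightarrow> 'r) set" where
  "tensor_null R M N = generated_submodule R (free_module R (carrier M \<times> carrier N))
     (tensor_relations R M N)"

definition tensor ::
    "'r ring \<Rightarrow> ('r, 'a) module \<Rightarrow> ('r, 'b) module \<Rightarrow> ('r, ('a \<times> 'b \<Rightarrow> 'r) set) module" where
  "tensor R M N = quotient_module (free_module R (carrier M \<times> carrier N)) (tensor_null R M N)"

definition pure_tensor ::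
    "'r ring \<Rightarrow> ('r, 'a) module \<Rightarrow> ('r, 'b) module \<Rightarrow> 'a \<Rightarrow> 'b \<Rightarrow> ('a \<times> 'b \<Rightarrow> 'r) set" where
  "pure_tensor R M N x y =
     tensor_null R M N +>\<^bsub>free_module R (carrier M \<times> carrier N)\<^esub> free_gen R (x, y)"

text \<open>The homomorphism \<open>f \<otimes> id\<close> on \<open>M \<otimes> N\<close>, for a homomorphism \<open>f\<close> from \<open>M\<close> to \<open>M'\<close>.
  Being extensional is what makes it unique as a function on the whole type.\<close>

definition tensor_map :: "'r ring \<Rightarrow> ('r, 'a) module \<Rightarrow> ('r, 'c) module \<Rightarrow> ('r, 'b) module \<Rightarrow>
    ('a \<Rightarrow> 'c) \<Rightarrow> ('a \<times> 'b \<Rightarrow> 'r) set \<Rightarrow> ('c \<times> 'b \<Rightarrow> 'r) set" where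
  "tensor_map R M M' N f = (THE h.
     h \<in> module_hom R (tensor R M N) (tensor R M' N) \<and>
     h \<in> extensional (carrier (tensor R M N)) \<and>
     (\<forall>x\<in>carrier M. \<forall>y\<in>carrier N. h (pure_tensor R M N x y) = pure_tensor R M' N (f x) y))"

subsection \<open>Projective resolutions and their homology\<close>

text \<open>Projective modules are the direct summands of free modules.  Taking the basis \<open>X\<close> of the free
  module to be of the element type of \<open>P\<close> is no restriction, as \<open>X\<close> can always be chosen to be
  \<open>carrier P\<close>.\<close>

definition projective_module :: "'r ring \<Rightarrow> ('r, 'p) module \<Rightarrow> bool" where
  "projective_module R P \<longleftrightarrow> module R P \<and>
     (\<exists>X :: 'p set. \<exists>i\<in>module_hom R P (free_module R X). \<exists>q\<in>module_hom R (free_module R X) P.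
        \<forall>x\<in>carrier P. q (i x) = x)"

text \<open>Exactness of \<open>\<dots> \<rightarrow> P 2 \<rightarrow> P 1 \<rightarrow> P 0 \<rightarrow> M \<rightarrow> 0\<close>, where \<open>d n\<close> maps \<open>P (n + 1)\<close> to \<open>P n\<close>
  and \<open>\<epsilon>\<close> is the augmentation.\<close>

definition projective_resolution :: "'r ring \<Rightarrow> (nat \<Rightarrow> ('r, 'p) module) \<Rightarrow>
    (nat \<Rightarrow> 'p \<Rightarrow> 'p) \<Rightarrow> ('p \<Rightarrow> 'a) \<Rightarrow> ('r, 'a) module \<Rightarrow> bool" where
  "projective_resolution R P d \<epsilon> M \<longleftrightarrow>
     (\<forall>n. projective_module R (P n)) \<and>
     (\<forall>n. d n \<in> module_hom R (P (Suc n)) (P n)) \<and>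
     \<epsilon> \<in> module_hom R (P 0) M \<and>
     \<epsilon> ` carrier (P 0) = carrier M \<and>
     d 0 ` carrier (P (Suc 0)) = hom_kernel (P 0) M \<epsilon> \<and>
     (\<forall>n. d (Suc n) ` carrier (P (Suc (Suc n))) = hom_kernel (P (Suc n)) (P n) (d n))"

text \<open>If \<open>(P, d)\<close> is a projective resolution of \<open>M\<close>, then \<open>Tor R P d N n\<close> is the \<open>n\<close>-th Tor module
  of \<open>M\<close> and \<open>N\<close>: the \<open>n\<close>-th homology of the complex \<open>P \<otimes> N\<close>.\<close>

definition Tor_cycles ::
    "'r ring \<Rightarrow> (nat \<Rightarrow> ('r, 'p) module) \<Rightarrow> (nat \<Rightarrow> 'p \<Rightarrow> 'p) \<Rightarrow> ('r, 'b) module \<Rightarrow> nat \<Rightarrow>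
      ('p \<times> 'b \<Rightarrow> 'r) set set" where
  "Tor_cycles R P d N n = (case n of
      0 \<Rightarrow> carrier (tensor R (P 0) N)
    | Suc m \<Rightarrow> hom_kernel (tensor R (P (Suc m)) N) (tensor R (P m) N)
                 (tensor_map R (P (Suc m)) (P m) N (d m)))"

definition Tor_boundaries ::
    "'r ring \<Rightarrow> (nat \<Rightarrow> ('r, 'p) module) \<Rightarrow> (nat \<Rightarrow> 'p \<Rightarrow> 'p) \<Rightarrow> ('r, 'b) module \<Rightarrow> nat \<Rightarrow>
      ('p \<times> 'b \<Rightarrow> 'r) set set" where
  "Tor_boundaries R P d N n =
     tensor_map R (P (Suc n)) (P n) N (d n) ` carrier (tensor R (P (Suc n)) N)"

definition Tor ::
    "'r ring \<Rightarrow> (nat \<Rightarrow> ('r, 'p) module) \<Rightarrow> (nat \<Rightarrow> 'p \<Rightarrow> 'p) \<Rightarrow> ('r, 'b) module \<Rightarrow> nat \<Rightarrow>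
      ('r, ('p \<times> 'b \<Rightarrow> 'r) set set) module" where
  "Tor R P d N n = quotient_module
     ((tensor R (P n) N)\<lparr>carrier := Tor_cycles R P d N n\<rparr>) (Tor_boundaries R P d N n)"

abbreviation ring_mod_ideal :: "'r ring \<Rightarrow> 'r set \<Rightarrow> ('r, 'r set) module" where
  "ring_mod_ideal R I \<equiv> quotient_module (regular_module R) I"

end

(* Put I = L + Q. At a four-valent vertex the relations L(p) and Q(p), and at a two-valent vertex the
   relation Q(p), say exactly that the product of X - U_e over the outgoing edges and the product over
   the incoming edges agree in (R/I)[X]. Multiply these equations over the vertices of W'. Every edge
   leaves at most one vertex and enters at most one vertex, so an edge inside W' contributes the same
   factor to both sides, and it can be cancelled because X - U_e is monic. Setting X = 0 gives N(W') in I.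
   Conversely Q(p) is a multiple of N({p}).

   That distinct germs at vertices lie on distinct edges is shown with a locally constant function on
   the complement of the vertices: whether walking down the arcs (and closing strands) from a point
   first meets a given vertex along a given arc.

   For the module statement, every element of P_0 tensor R/J has the form p tensor 1, which identifies
   Tor_0(R/I, R/J) with R/(I + J) for any resolution. *)

theory Submission
  imports Defs
begin

section \<open>Arcs joined by strands\<close>

text \<open>Multiplying the relations \<open>Q(p)\<close> themselves would leave the variables of
  the inner edges as a common factor, and these may be zero divisors modulo \<open>I\<close>. This
  is why an indeterminate is adjoined; \<open>L(p)\<close> then appears as a coefficient. Taking
  constant coefficients costs one sign per edge, which is the same on both sides because every
  vertex has as many outgoing as incoming edges.

  Edges are connected components of a plane set, so these counts and the uniqueness of the vertex
  that an edge leaves are topological facts. Off the vertices arcs and strands do not branch, hence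
  the walk down from a point is determined. Walking down treats outgoing edges; incoming edges
  follow by reversing all parameters.

  The two Tor modules may come from different resolutions. Both are compared with one quotient of
  the ring, so no chain map between resolutions has to be built.\<close>

text \<open>The strand \<open>h j\<close> leads from the upper end of the arc \<open>a j\<close> to the lower end of the arc \<open>b j\<close>.\<close>

locale arc_system =
  fixes n m :: nat and g h :: "nat \<Rightarrow> real \<Rightarrow> plane" and a b :: "nat \<Rightarrow> nat" and V :: "plane set"
  assumes cont_g: "i < n \<Longrightarrow> continuous_on {0..1} (g i)"
    and inj_g: "i < n \<Longrightarrow> inj_on (g i) {0..1}"
    and cross: "\<lbrakk>i < n; j < n; i \<noteq> j; s \<in> {0..1}; t \<in> {0..1}; g i s = g j t\<rbrakk> \<Longrightarrow> g i s \<in> V"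
    and finite_V: "finite V"
    and cont_h: "j < m \<Longrightarrow> continuous_on {0..1} (h j)"
    and a_less: "j < m \<Longrightarrow> a j < n" and b_less: "j < m \<Longrightarrow> b j < n"
    and a_inj: "inj_on a {..<m}" and b_inj: "inj_on b {..<m}"
    and h_ends: "j < m \<Longrightarrow> h j 0 = g (a j) 1" "j < m \<Longrightarrow> h j 1 = g (b j) 0"
    and h_inner: "\<lbrakk>j < m; i < n; s \<in> {0<..<1}; t \<in> {0..1}\<rbrakk> \<Longrightarrow> h j s \<noteq> g i t"
    and h_disj: "\<lbrakk>i < m; j < m; i \<noteq> j\<rbrakk> \<Longrightarrow> h i ` {0..1} \<inter> h j ` {0..1} = {}"
begin

section \<open>The downward walk and the label it gives to a point\<close>

definition total :: "plane set" where
  "total = (\<Union>i<n. g i ` {0..1}) \<union> (\<Union>j<m. h j ` {0..1})"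

text \<open>\<open>fed i0 s0 i\<close> and \<open>reached i0 s0 i t\<close> mean that the downward walk from \<open>g i 0\<close> and from \<open>g i t\<close>
  respectively first meets \<open>V\<close> at the parameter \<open>s0\<close> of the arc \<open>i0\<close>.  A walk running around forever
  is excluded by the induction.\<close>

inductive fed :: "nat \<Rightarrow> real \<Rightarrow> nat \<Rightarrow> bool" for i0 s0 where
  germ: "\<lbrakk>j < m; a j = i0; \<forall>u\<in>{s0<..<1}. g i0 u \<notin> V\<rbrakk> \<Longrightarrow> fed i0 s0 (b j)"
| pass: "\<lbrakk>j < m; fed i0 s0 (a j); \<forall>u\<in>{0..<1}. g (a j) u \<notin> V\<rbrakk> \<Longrightarrow> fed i0 s0 (b j)"

definition reached :: "nat \<Rightarrow> real \<Rightarrow> nat \<Rightarrow> real \<Rightarrow> bool" where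
  "reached i0 s0 i t \<longleftrightarrow> (i = i0 \<and> s0 < t \<and> (\<forall>u\<in>{s0<..<t}. g i u \<notin> V)) \<or>
     (fed i0 s0 i \<and> (\<forall>u\<in>{0..<t}. g i u \<notin> V))"

text \<open>A whole strand will carry one label, so the label has to agree at its two ends. The two
  rules of \<open>fed\<close> are the two ways of being reached at the top of \<open>a j\<close>,
  and injectivity of \<open>b\<close> ensures that no other strand ends at the arc
  \<open>b j\<close>. The bound \<open>0 \<le> s0\<close> excludes the first alternative of
  \<open>reached\<close> at parameter 0.\<close>

lemma reached_strand:
  assumes "j < m" "0 \<le> s0" "s0 < 1"
  shows "reached i0 s0 (b j) 0 \<longleftrightarrow> reached i0 s0 (a j) 1"
proof -
  have "fed i0 s0 (b j) \<longleftrightarrow> (a j = i0 \<and> (\<forall>u\<in>{s0<..<1}. g i0 u \<notin> V)) \<or>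
      (fed i0 s0 (a j) \<and> (\<forall>u\<in>{0..<1}. g (a j) u \<notin> V))"
    using assms(1) b_inj by (subst fed.simps) (auto simp: inj_on_def)
  then show ?thesis using assms by (auto simp: reached_def)
qed

lemma finite_params: "i < n \<Longrightarrow> finite {u \<in> {0..1}. g i u \<in> V}"
  using finite_vimage_IntI[OF finite_V inj_g] by (simp add: vimage_def Int_def conj_commute)

text \<open>The parameter \<open>t\<close> may itself belong to a vertex, so the gap serves points
  off \<open>V\<close> as well as germs at a vertex.\<close>

lemma params_gap:
  assumes "i < n"
  obtains r where "0 < r" "\<And>u. \<lbrakk>u \<in> {0..1}; u \<noteq> t; \<bar>u - t\<bar> < r\<rbrakk> \<Longrightarrow> g i u \<notin> V"
proof -
  from finite_set_avoid[OF finite_params[OF assms], of t] obtain r where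
    "0 < r" "\<forall>u\<in>{u \<in> {0..1}. g i u \<in> V}. u \<noteq> t \<longrightarrow> r \<le> dist t u" by blast
  then show thesis by (intro that[of r]) (auto simp: dist_real_def abs_minus_commute not_le dest!: bspec)
qed

text \<open>The label depends on \<open>t\<close> only through the parameters of \<open>V\<close>
  lying below \<open>t\<close>, and near a point off \<open>V\<close> these do not change. On the
  arc \<open>i0\<close> the value \<open>s0\<close> is one of them, so the comparison with
  \<open>s0\<close> is covered too.\<close>

lemma reached_locally_constant:
  assumes "i < n" "t \<in> {0..1}" "g i t \<notin> V" "g i0 s0 \<in> V"  "0 \<le> s0" "s0 < 1"
  obtains r where "0 < r" "\<And>u. \<lbrakk>u \<in> {0..1}; \<bar>u - t\<bar> < r\<rbrakk> \<Longrightarrow> reached i0 s0 i u = reached i0 s0 i t"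
proof -
  obtain r where r: "0 < r" "\<And>u. \<lbrakk>u \<in> {0..1}; u \<noteq> t; \<bar>u - t\<bar> < r\<rbrakk> \<Longrightarrow> g i u \<notin> V"
    using params_gap[OF assms(1)] by metis
  then have free: "g i u \<notin> V" if "u \<in> {0..1}" "\<bar>u - t\<bar> < r" for u
    using that assms(3) by metis
  show thesis
  proof (rule that[OF r(1)])
    fix u assume u: "u \<in> {0..1}" "\<bar>u - t\<bar> < r"
    have same: "v < u \<longleftrightarrow> v < t" if "g i v \<in> V" "0 \<le> v" for v
    proof (cases "v \<le> 1")
      case True
      then have "r \<le> \<bar>v - t\<bar>" using free[of v] that by force
      then show ?thesis using u(2) by arith
    qed (use u assms(2) in auto)
    have "(\<forall>v\<in>{0..<u}. g i v \<notin> V) = (\<forall>v\<in>{0..<t}. g i v \<notin> V)"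
      using same by auto
    moreover have "(i = i0 \<and> s0 < u \<and> (\<forall>v\<in>{s0<..<u}. g i v \<notin> V)) =
       (i = i0 \<and> s0 < t \<and> (\<forall>v\<in>{s0<..<t}. g i v \<notin> V))"
    proof (cases "i = i0")
      case True
      then have "s0 < u \<longleftrightarrow> s0 < t" using same[of s0] assms(4,5) by simp
      moreover have "v < u \<longleftrightarrow> v < t" if "g i v \<in> V" "s0 < v" for v
        using same[of v] that assms(5) by simp
      ultimately show ?thesis by auto
    qed simp
    ultimately show "reached i0 s0 i u = reached i0 s0 i t"
      unfolding reached_def by simp
  qed
qed

text \<open>The closures add only points of \<open>V\<close>, so off \<open>V\<close> the two sides are the level sets of the
  label.\<close>

definition side :: "nat \<Rightarrow> real \<Rightarrow> bool \<Rightarrow> plane set" where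
  "side i0 s0 c =
     (\<Union>i<n. g i ` closure {t \<in> {0..1}. g i t \<notin> V \<and> reached i0 s0 i t = c}) \<union>
     (\<Union>j\<in>{j. j < m \<and> reached i0 s0 (a j) 1 = c}. h j ` {0..1})"

text \<open>Closures are taken in the parameter interval, where they are compact; their continuous
  images are closed, and there are finitely many arcs and strands.\<close>

lemma closed_side: "closed (side i0 s0 c)"
proof -
  have sub: "closure {t \<in> {0..1}. g i t \<notin> V \<and> reached i0 s0 i t = c} \<subseteq> {0..1}" for i
    by (rule closure_minimal) auto
  have "compact (closure {t \<in> {0..1}. g i t \<notin> V \<and> reached i0 s0 i t = c})" for i
    using compact_Int_closed[OF compact_Icc[of 0 "1::real"] closed_closure, of "{t \<in> {0..1}. g i t \<notin> V \<and> reached i0 s0 i t = c}"]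
     sub[of i] by (simp add: Int_absorb1)
  then have "compact (g i ` closure {t \<in> {0..1}. g i t \<notin> V \<and> reached i0 s0 i t = c})" if "i < n" for i
    by (intro compact_continuous_image continuous_on_subset[OF cont_g[OF that] sub])
  moreover have "compact (h j ` {0..1})" if "j < m" for j
    by (intro compact_continuous_image cont_h that compact_Icc)
  ultimately show ?thesis unfolding side_def
    by (intro closed_Un closed_UN) (auto intro: compact_imp_closed)
qed

lemma total_subset_sides: "total - V \<subseteq> side i0 s0 True \<union> side i0 s0 False"
proof
  fix x assume x: "x \<in> total - V"
  then consider i t where "i < n" "t \<in> {0..1}" "x = g i t" "g i t \<notin> V" | j where "j < m" "x \<in> h j ` {0..1}"
    unfolding total_def by blast
  then show "x \<in> side i0 s0 True \<union> side i0 s0 False"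
  proof cases
    case 1
    then show ?thesis unfolding side_def
      by (cases "reached i0 s0 i t") (auto intro!: UN_I imageI subsetD[OF closure_subset])
  next
    case 2
    then show ?thesis unfolding side_def by (cases "reached i0 s0 (a j) 1") blast+
  qed
qed

text \<open>The interior of a strand avoids all arcs, so they can only meet at an end of the strand,
  which is an end of \<open>a j\<close> or \<open>b j\<close>. Any other arc through that point
  would cross there, hence in \<open>V\<close>.\<close>

lemma strand_meets_arc:
  assumes "j < m" "i < n" "s \<in> {0..1}" "t \<in> {0..1}" "h j s = g i t" "g i t \<notin> V"
  shows "i = a j \<and> t = 1 \<or> i = b j \<and> t = 0"
proof -
  have "s = 0 \<or> s = 1" using h_inner[OF assms(1,2) _ assms(4), of s] assms(3,5) by force
  then show ?thesis
  proof
    assume "s = 0"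
    then have e: "g i t = g (a j) 1" using h_ends assms by simp
    then have "i = a j" using cross[OF assms(2) a_less[OF assms(1)] _ assms(4), of 1] assms by auto
    then show ?thesis using e inj_g[OF assms(2)] assms by (auto simp: inj_on_def)
  next
    assume "s = 1"
    then have e: "g i t = g (b j) 0" using h_ends assms by simp
    then have "i = b j" using cross[OF assms(2) b_less[OF assms(1)] _ assms(4), of 0] assms by auto
    then show ?thesis using e inj_g[OF assms(2)] assms by (auto simp: inj_on_def)
  qed
qed

text \<open>There are parameters with label \<open>c\<close> arbitrarily close to \<open>t\<close>,
  and the label is constant near \<open>t\<close>.\<close>

lemma reached_closure:
  assumes "i < n" "t \<in> closure {t \<in> {0..1}. g i t \<notin> V \<and> reached i0 s0 i t = c}" "g i t \<notin> V"
    and "g i0 s0 \<in> V"  "0 \<le> s0" "s0 < 1"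
  shows "t \<in> {0..1}" "reached i0 s0 i t = c"
proof -
  have "closure {t \<in> {0..1}. g i t \<notin> V \<and> reached i0 s0 i t = c} \<subseteq> {0..1}"
    by (rule closure_minimal) auto
  then show t: "t \<in> {0..1}" using assms by auto
  obtain r where r: "0 < r" "\<And>u. \<lbrakk>u \<in> {0..1}; \<bar>u - t\<bar> < r\<rbrakk> \<Longrightarrow> reached i0 s0 i u = reached i0 s0 i t"
    using reached_locally_constant[OF assms(1) t assms(3-6)] by metis
  then show "reached i0 s0 i t = c"
    using assms(2) unfolding closure_approachable dist_real_def by blast
qed

lemma side_cases:
  assumes "x \<in> side i0 s0 c" "x \<notin> V" and s0: "g i0 s0 \<in> V"  "0 \<le> s0" "s0 < 1"
  obtains i t where "i < n" "t \<in> {0..1}" "x = g i t" "reached i0 s0 i t = c"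
    | j s where "j < m" "s \<in> {0..1}" "x = h j s" "reached i0 s0 (a j) 1 = c"
proof -
  from assms(1) consider i t where "i < n" "x = g i t" "t \<in> closure {t \<in> {0..1}. g i t \<notin> V \<and> reached i0 s0 i t = c}"
    | j s where "j < m" "s \<in> {0..1}" "x = h j s" "reached i0 s0 (a j) 1 = c"
    unfolding side_def by blast
  then show thesis
  proof cases
    case 1
    with reached_closure[OF 1(1,3) _ s0] assms(2) that(1) show thesis by metis
  next
    case 2 then show thesis using that(2) by metis
  qed
qed

text \<open>Off \<open>V\<close>, two descriptions of a point on arcs coincide, and two descriptions
  on strands use the same strand. Only a junction of a strand with an arc compares labels taken at
  different places; there \<open>reached_strand\<close> applies.\<close>

lemma sides_disjoint:
  assumes s0: "g i0 s0 \<in> V"  "0 \<le> s0" "s0 < 1"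
  shows "side i0 s0 True \<inter> side i0 s0 False \<subseteq> V"
proof
  fix x assume "x \<in> side i0 s0 True \<inter> side i0 s0 False"
  then have T: "x \<in> side i0 s0 True" and F: "x \<in> side i0 s0 False" by auto
  have mixed: False if "i < n" "t \<in> {0..1}" "j < m" "s \<in> {0..1}" "x = g i t" "x = h j s" "x \<notin> V"
     "reached i0 s0 i t \<noteq> reached i0 s0 (a j) 1" for i t j s
    using strand_meets_arc[OF that(3,1,4,2)] that reached_strand[OF that(3) s0(2,3)] by auto
  show "x \<in> V"
  proof (rule ccontr)
    assume x: "x \<notin> V"
    show False
    proof (rule side_cases[OF T x s0]; rule side_cases[OF F x s0])
      fix i t i' t' assume *: "i < n" "t \<in> {0..1}" "x = g i t" "reached i0 s0 i t = True"
        "i' < n" "t' \<in> {0..1}" "x = g i' t'" "reached i0 s0 i' t' = False"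
      then have "i = i'" using cross[of i i' t t'] x by auto
      then have "t = t'" using * inj_g[of i] by (auto simp: inj_on_def)
      with * \<open>i = i'\<close> show False by simp
    next
      fix j s j' s' assume *: "j < m" "s \<in> {0..1}" "x = h j s" "reached i0 s0 (a j) 1 = True"
        "j' < m" "s' \<in> {0..1}" "x = h j' s'" "reached i0 s0 (a j') 1 = False"
      then have "j \<noteq> j'" by auto
      then show False using h_disj[OF *(1,5)] * by blast
    qed (use mixed x in blast)+
  qed
qed

text \<open>The label belonging to \<open>(i, s)\<close> is true just above \<open>g i s\<close> and
  false just above any other germ at a vertex. A connected set containing two different germs would
  meet both sides, which are closed, cover it and are disjoint on it.\<close>

theorem germ_determined_by_component:
  assumes C: "connected C" "C \<subseteq> total - V"
    and i: "i < n" "s \<in> {0<..<1}" "g i s \<in> V" "\<forall>\<^sub>F t in at_right s. g i t \<in> C"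
    and j: "j < n" "s' \<in> {0<..<1}" "g j s' \<in> V" "\<forall>\<^sub>F t in at_right s'. g j t \<in> C"
  shows "i = j \<and> s = s'"
proof (rule ccontr)
  assume ne: "\<not> (i = j \<and> s = s')"
  have s0: "0 \<le> s" "s < 1" using i by auto
  have pt: "\<exists>x\<in>C. x \<in> side i s c" if k: "k < n" "u \<in> {0<..<1}" "\<forall>\<^sub>F t in at_right u. g k t \<in> C"
    "c = (k = i \<and> u = s)" and kV: "g k u \<in> V"  for k u c
  proof -
    obtain r where r: "0 < r" "\<And>v. \<lbrakk>v \<in> {0..1}; v \<noteq> u; \<bar>v - u\<bar> < r\<rbrakk> \<Longrightarrow> g k v \<notin> V"
      using params_gap[OF k(1)] by metis
    have "\<forall>\<^sub>F t in at_right u. t \<in> {u<..<min 1 (u+r)}"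
      using k r by (intro eventually_at_rightI[of u "min 1 (u+r)"]) auto
    with k(3) have "\<forall>\<^sub>F t in at_right u. g k t \<in> C \<and> t \<in> {u<..<min 1 (u+r)}"
      by (rule eventually_conj)
    then obtain t where t: "g k t \<in> C" "t \<in> {u<..<min 1 (u+r)}"
      using eventually_happens'[OF trivial_limit_at_right_real] by blast
    have free: "g k v \<notin> V" if "v \<in> {u<..t}" for v
      using r(2)[of v] that t k(2) by auto
    have "reached i s k t = c"
    proof (cases "k = i \<and> u = s")
      case True
      then show ?thesis using free t k(4) by (auto simp: reached_def)
    next
      case False
      \<comment> \<open>The vertex at \<open>u\<close> blocks every walk from \<open>t\<close> that
        leaves the arc at its bottom, so \<open>k = i\<close>. Then \<open>u\<close> and
        \<open>s\<close> are two vertex parameters below \<open>t\<close> on the same arc, and each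
        would have to be the last one.\<close>
      have "\<not> reached i s k t"
      proof
        assume "reached i s k t"
        moreover have "u \<in> {0..<t}" using t k by auto
        ultimately have *: "k = i" "s < t" "\<forall>v\<in>{s<..<t}. g k v \<notin> V"
          using kV by (auto simp: reached_def)
        with \<open>u \<in> {0..<t}\<close> kV have "u \<le> s" by fastforce
        with False * have "u < s" by auto
        then show False using free[of s] * i(3) by auto
      qed
      with False k(4) show ?thesis by simp
    qed
    then have "t \<in> {t \<in> {0..1}. g k t \<notin> V \<and> reached i s k t = c}"
      using t k free[of t] by auto
    then show ?thesis
      using k(1) t(1) unfolding side_def by (blast intro: subsetD[OF closure_subset])
  qed
  obtain x y where "x \<in> C \<inter> side i s True" "y \<in> C \<inter> side i s False"
    using pt[OF i(1,2,4) _ i(3), of True] pt[OF j(1,2,4) _ j(3), of False] ne by auto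
  moreover have "C \<subseteq> side i s True \<union> side i s False"
    using total_subset_sides C(2) by blast
  moreover have "side i s True \<inter> side i s False \<inter> C = {}"
    using sides_disjoint[OF i(3) s0] C(2) by blast
  ultimately show False
    using C(1) closed_side[of i s True] closed_side[of i s False] unfolding connected_closed by blast
qed

section \<open>Counting the edges at a vertex by germs of arcs\<close>

lemma germ_in_component:
  assumes "i < n" "s \<in> {0<..<1}"
  obtains e where "e \<in> components (total - V)" "\<forall>\<^sub>F t in at_right s. g i t \<in> e"
proof -
  obtain r where r: "0 < r" "\<And>v. \<lbrakk>v \<in> {0..1}; v \<noteq> s; \<bar>v - s\<bar> < r\<rbrakk> \<Longrightarrow> g i v \<notin> V"
    using params_gap[OF assms(1)] by metis
  define t where "t = min 1 (s + r)"
  have st: "s < t" "t \<le> 1" using assms r by (auto simp: t_def)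
  have sub: "g i ` {s<..<t} \<subseteq> total - V"
    using assms st r(2) by (auto simp: total_def t_def)
  moreover have "connected (g i ` {s<..<t})"
    using assms st by (intro connected_continuous_image continuous_on_subset[OF cont_g]) auto
  moreover have "g i ` {s<..<t} \<noteq> {}" using st by auto
  ultimately obtain e where "e \<in> components (total - V)" "g i ` {s<..<t} \<subseteq> e"
    using exists_component_superset[of "g i ` {s<..<t}" "total - V"] by blast
  moreover from this have "\<forall>\<^sub>F u in at_right s. g i u \<in> e"
    using st by (intro eventually_at_rightI[of s t]) auto
  ultimately show thesis using that by blast
qed

text \<open>For the arcs of a partial braid graph this becomes \<open>out_edges\<close>, and for the
  reversed system \<open>in_edges\<close>.\<close>

definition germs_up :: "plane \<Rightarrow> plane set set" where
  "germs_up p = {e \<in> components (total - V). \<exists>i<n. \<exists>s\<in>{0<..<1}.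
     g i s = p \<and> (\<forall>\<^sub>F t in at_right s. g i t \<in> e)}"

lemma germs_up_disjoint:
  assumes "p \<in> V" "q \<in> V" "p \<noteq> q"
  shows "germs_up p \<inter> germs_up q = {}"
proof (rule equals0I)
  fix e assume "e \<in> germs_up p \<inter> germs_up q"
  then obtain i s j s' where *: "e \<in> components (total - V)"
    "i < n" "s \<in> {0<..<1}" "g i s = p" "\<forall>\<^sub>F t in at_right s. g i t \<in> e"
    "j < n" "s' \<in> {0<..<1}" "g j s' = q" "\<forall>\<^sub>F t in at_right s'. g j t \<in> e"
    unfolding germs_up_def by blast
  with germ_determined_by_component[of e i s j s'] assms show False
    by (auto dest: in_components_connected in_components_subset)
qed

text \<open>An injective arc passes through \<open>p\<close> at one parameter only, and its germ
  there lies in a single component because components do not overlap. Different arcs have germs in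
  different components by \<open>germ_determined_by_component\<close>, so two arcs crossing at
  \<open>p\<close> really give two edges.\<close>

lemma bij_betw_germs_up:
  assumes "p \<in> V"
  shows "\<exists>\<phi>. bij_betw \<phi> {i. i < n \<and> p \<in> g i ` {0<..<1}} (germs_up p)"
proof -
  let ?I = "{i. i < n \<and> p \<in> g i ` {0<..<1}}"
  define R where "R i e \<longleftrightarrow> e \<in> components (total - V) \<and> (\<exists>s\<in>{0<..<1}. g i s = p \<and> (\<forall>\<^sub>F t in at_right s. g i t \<in> e))" for i e
  have ex: "\<exists>e. R i e" if "i \<in> ?I" for i
    using that germ_in_component[of i] unfolding R_def by (smt (verit) image_iff mem_Collect_eq)
  have inj: "i = j" if "i \<in> ?I" "j \<in> ?I" "R i e" "R j e" for i j e
  proof -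
    obtain s s' where "s \<in> {0<..<1}" "g i s = p" "\<forall>\<^sub>F t in at_right s. g i t \<in> e"
      "s' \<in> {0<..<1}" "g j s' = p" "\<forall>\<^sub>F t in at_right s'. g j t \<in> e"
      using \<open>R i e\<close> \<open>R j e\<close> unfolding R_def by blast
    then show ?thesis using germ_determined_by_component[of e i s j s'] that assms
      by (auto simp: R_def dest: in_components_connected in_components_subset)
  qed
  have unique: "e = f" if "i \<in> ?I" "R i e" "R i f" for i e f
  proof -
    obtain s s' where *: "s \<in> {0<..<1}" "g i s = p" "\<forall>\<^sub>F t in at_right s. g i t \<in> e"
      "s' \<in> {0<..<1}" "g i s' = p" "\<forall>\<^sub>F t in at_right s'. g i t \<in> f"
      using \<open>R i e\<close> \<open>R i f\<close> unfolding R_def by blast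
    then have "s = s'" using inj_g[of i] \<open>i \<in> ?I\<close> by (auto simp: inj_on_def)
    with * have "\<forall>\<^sub>F t in at_right s. g i t \<in> e \<and> g i t \<in> f" by (simp add: eventually_conj)
    then obtain t where "g i t \<in> e \<inter> f"
      using eventually_happens'[OF trivial_limit_at_right_real] by blast
    then show ?thesis using that components_nonoverlap[of e "total - V" f] unfolding R_def by blast
  qed
  define \<phi> where "\<phi> i = (SOME e. R i e)" for i
  have \<phi>: "R i (\<phi> i)" if "i \<in> ?I" for i
    unfolding \<phi>_def using ex[OF that] by (rule someI_ex)
  have "germs_up p = {e. \<exists>i\<in>?I. R i e}"
    unfolding germs_up_def R_def by blast
  also have "\<dots> = \<phi> ` ?I" using \<phi> unique by blast
  finally have "germs_up p = \<phi> ` ?I" .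
  moreover have "inj_on \<phi> ?I"
  proof (rule inj_onI)
    fix i j assume ij: "i \<in> ?I" "j \<in> ?I" "\<phi> i = \<phi> j"
    show "i = j" using inj[OF ij(1,2) \<phi>[OF ij(1)]] \<phi>[OF ij(2)] unfolding ij(3) by iprover
  qed
  ultimately show ?thesis by (auto simp: bij_betw_def)
qed

text \<open>Reversal turns the part of an arc below a vertex into the part above it, so each
  statement on outgoing germs yields one on incoming germs. A reversed strand starts at the old
  lower end of \<open>b j\<close>; hence \<open>a\<close> and \<open>b\<close> change
  places.\<close>

lemma reversed: "arc_system n m (\<lambda>i t. g i (1 - t)) (\<lambda>j t. h j (1 - t)) b a V"
proof
  have minus_image: "(\<lambda>t::real. 1 - t) ` {0..1} = {0..1}" by simp
  show "continuous_on {0..1} (\<lambda>t. g i (1 - t))" if "i < n" for i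
    by (rule continuous_on_compose2[OF cont_g[OF that]]) (auto intro!: continuous_intros)
  show "continuous_on {0..1} (\<lambda>t. h j (1 - t))" if "j < m" for j
    by (rule continuous_on_compose2[OF cont_h[OF that]]) (auto intro!: continuous_intros)
  show "inj_on (\<lambda>t. g i (1 - t)) {0..1}" if "i < n" for i
  proof (rule inj_onI)
    fix s t :: real assume "s \<in> {0..1}" "t \<in> {0..1}" "g i (1 - s) = g i (1 - t)"
    then show "s = t" using inj_onD[OF inj_g[OF that], of "1 - s" "1 - t"] by simp
  qed
  show "g i (1 - s) \<in> V" if "i < n" "j < n" "i \<noteq> j" "s \<in> {0..1}" "t \<in> {0..1}" "g i (1 - s) = g j (1 - t)" for i j s t
    using cross[of i j "1 - s" "1 - t"] that by auto
  show "h j (1 - s) \<noteq> g i (1 - t)" if "j < m" "i < n" "s \<in> {0<..<1}" "t \<in> {0..1}" for i j s t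
    using h_inner[of j i "1 - s" "1 - t"] that by auto
  have "(\<lambda>t. h j (1 - t)) ` {0..1} = h j ` {0..1}" for j
    using image_image[of "h j" "\<lambda>t. 1 - t" "{0..1}"] minus_image by simp
  then show "(\<lambda>t. h i (1 - t)) ` {0..1} \<inter> (\<lambda>t. h j (1 - t)) ` {0..1} = {}" if "i < m" "j < m" "i \<noteq> j" for i j
    using h_disj[OF that] by simp
qed (use finite_V a_less b_less a_inj b_inj h_ends in auto)

end

lemma eventually_at_left_reflect:
  fixes s :: real
  shows "(\<forall>\<^sub>F t in at_left s. P t) \<longleftrightarrow> (\<forall>\<^sub>F t in at_right (1 - s). P (1 - t))"
proof -
  have "(\<exists>b<s. \<forall>y>b. y < s \<longrightarrow> P y) \<longleftrightarrow> (\<exists>b>1 - s. \<forall>y>1 - s. y < b \<longrightarrow> P (1 - y))"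
  proof
    assume "\<exists>b<s. \<forall>y>b. y < s \<longrightarrow> P y"
    then obtain b where "b < s" "\<forall>y>b. y < s \<longrightarrow> P y" by blast
    then show "\<exists>b>1 - s. \<forall>y>1 - s. y < b \<longrightarrow> P (1 - y)" by (intro exI[of _ "1 - b"]) auto
  next
    assume "\<exists>b>1 - s. \<forall>y>1 - s. y < b \<longrightarrow> P (1 - y)"
    then obtain b where b: "b > 1 - s" "\<forall>y>1 - s. y < b \<longrightarrow> P (1 - y)" by blast
    have "P y" if "1 - b < y" "y < s" for y using b(2)[rule_format, of "1 - y"] that by simp
    with b(1) show "\<exists>b<s. \<forall>y>b. y < s \<longrightarrow> P y" by (intro exI[of _ "1 - b"]) auto
  qed
  then show ?thesis by (simp only: eventually_at_left_field eventually_at_right_field)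
qed

section \<open>Edges at a vertex of a partial braid graph\<close>

lemma smooth_arc_differentiable: "smooth_arc g \<Longrightarrow> g differentiable_on {0..1}"
  unfolding smooth_arc_def by (metis funpow_0)

text \<open>The height is strictly increasing along the arc, since its derivative is the second
  coordinate of the velocity.\<close>

lemma rising_arc_inj:
  assumes "g differentiable_on {0..1}" "\<forall>t\<in>{0..1}. 0 < snd (velocity g t)"
  shows "inj_on g {0..1}"
proof -
  have cont: "continuous_on {0..1} (\<lambda>t. snd (g t))"
    using differentiable_imp_continuous_on[OF assms(1)] by (intro continuous_intros)
  have less: "snd (g s) < snd (g t)" if "s \<in> {0..1}" "t \<in> {0..1}" "s < t" for s t
  proof (rule DERIV_pos_imp_increasing_open[OF \<open>s < t\<close>])
    fix x assume x: "s < x" "x < t"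
    then have "x \<in> {0..1}" using that by auto
    then have "(g has_vector_derivative velocity g x) (at x within {0..1})"
      using assms(1) by (simp add: differentiable_on_def vector_derivative_works)
    then have "((\<lambda>t. snd (g t)) has_vector_derivative snd (velocity g x)) (at x within {0..1})"
      by (rule bounded_linear.has_vector_derivative[OF bounded_linear_snd])
    then have "((\<lambda>t. snd (g t)) has_real_derivative snd (velocity g x)) (at x)"
      using x that by (simp add: has_real_derivative_iff_has_vector_derivative at_within_Icc_at)
    then show "\<exists>y. ((\<lambda>t. snd (g t)) has_real_derivative y) (at x) \<and> 0 < y"
      using assms(2) \<open>x \<in> {0..1}\<close> by blast
  qed (use cont that in \<open>auto intro: continuous_on_subset\<close>)
  show ?thesis
  proof (rule inj_onI, rule ccontr)
    fix s t :: real assume "s \<in> {0..1}" "t \<in> {0..1}" "g s = g t" "s \<noteq> t"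
    then show False using less[of s t] less[of t s] by (cases s t rule: linorder_cases) auto
  qed
qed

text \<open>Strands are attached by position in a sorted list of coordinates. This recovers the arc
  behind each position and supplies the maps \<open>a\<close> and \<open>b\<close> of an arc
  system.\<close>

lemma enumerated_endpoints:
  fixes f :: "nat \<Rightarrow> real"
  assumes "finite B" "inj_on f B"
  obtains a where "bij_betw a {..<card B} B" "\<And>j. j < card B \<Longrightarrow> f (a j) = sorted_list_of_set (f ` B) ! j"
proof -
  let ?l = "sorted_list_of_set (f ` B)"
  have "bij_betw (nth ?l) {..<card B} (f ` B)"
    using assms by (intro bij_betw_nth) (simp_all add: card_image)
  moreover have "bij_betw (inv_into B f) (f ` B) B"
    using assms(2) by (simp add: bij_betw_inv_into inj_on_imp_bij_betw)
  ultimately have "bij_betw (inv_into B f \<circ> nth ?l) {..<card B} B" by (rule bij_betw_trans)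
  moreover have "f ((inv_into B f \<circ> nth ?l) j) = ?l ! j" if "j < card B" for j
    using bij_betwE[OF \<open>bij_betw (nth ?l) {..<card B} (f ` B)\<close>] that by (simp add: f_inv_into_f)
  ultimately show thesis by (rule that)
qed

lemma arc_system_of_partial_braid_graph:
  assumes "partial_braid_graph S"
  obtains a b where "arc_system (num_arcs S) (card (bottom_arcs S)) (arc_of S) (strand_of S) a b (verts S)"
proof -
  have G: "open_partial_braid_graph S" using assms by (simp add: partial_braid_graph_def)
  have diff: "arc_of S i differentiable_on {0..1}" if "i < num_arcs S" for i
    using G that smooth_arc_differentiable by (simp add: open_partial_braid_graph_def)
  have rising: "\<forall>t\<in>{0..1}. 0 < snd (velocity (arc_of S i) t)" if "i < num_arcs S" for i
    using G that by (simp add: open_partial_braid_graph_def)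
  have square: "arc_of S i t \<in> {0..1} \<times> {0..1}" if "i < num_arcs S" "t \<in> {0..1}" for i t
    using conjunct1[OF G[unfolded open_partial_braid_graph_def]] that by blast
  have cross: "s \<in> {0<..<1} \<and> arc_of S i s \<in> verts S"
    if "i < num_arcs S" "j < num_arcs S" "i \<noteq> j" "s \<in> {0..1}" "t \<in> {0..1}" "arc_of S i s = arc_of S j t" for i j s t
    using G[unfolded open_partial_braid_graph_def, THEN conjunct2, THEN conjunct2, THEN conjunct2,
        THEN conjunct2, THEN conjunct1] that by blast
  have cards: "card (bottom_arcs S) = card (top_arcs S)" and fin: "finite (verts S)"
    using G by (simp_all add: open_partial_braid_graph_def)
  \<comment> \<open>Two arcs with a common lower endpoint would meet at parameter 0, but arcs meet
    only at interior parameters.\<close>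
  have inj_bottom: "inj_on (\<lambda>i. fst (arc_of S i 0)) (bottom_arcs S)"
  proof (rule inj_onI, rule ccontr)
    fix i j assume "i \<in> bottom_arcs S" "j \<in> bottom_arcs S" "fst (arc_of S i 0) = fst (arc_of S j 0)" "i \<noteq> j"
    then show False using cross[of i j 0 0] by (auto simp: bottom_arcs_def prod_eq_iff)
  qed
  have inj_top: "inj_on (\<lambda>i. fst (arc_of S i 1)) (top_arcs S)"
  proof (rule inj_onI, rule ccontr)
    fix i j assume "i \<in> top_arcs S" "j \<in> top_arcs S" "fst (arc_of S i 1) = fst (arc_of S j 1)" "i \<noteq> j"
    then show False using cross[of i j 1 1] by (auto simp: top_arcs_def prod_eq_iff)
  qed
  have "finite (bottom_arcs S)" "finite (top_arcs S)" by (simp_all add: bottom_arcs_def top_arcs_def)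
  \<comment> \<open>Top and bottom arcs are equally many, so a single index range numbers both ends
    of the strands.\<close>
  from enumerated_endpoints[OF this(1) inj_bottom] enumerated_endpoints[OF this(2) inj_top]
  obtain a b where a: "bij_betw a {..<card (bottom_arcs S)} (top_arcs S)"
    "\<And>j. j < card (bottom_arcs S) \<Longrightarrow> fst (arc_of S (a j) 1) = top_points S ! j"
    and b: "bij_betw b {..<card (bottom_arcs S)} (bottom_arcs S)"
    "\<And>j. j < card (bottom_arcs S) \<Longrightarrow> fst (arc_of S (b j) 0) = bottom_points S ! j"
    unfolding cards bottom_points_def top_points_def by metis
  have a_top: "a j \<in> top_arcs S" and b_bottom: "b j \<in> bottom_arcs S" if "j < card (bottom_arcs S)" for j
    using bij_betwE[OF a(1)] bij_betwE[OF b(1)] that by auto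
  have strands: "arc (strand_of S j)" "pathstart (strand_of S j) = (top_points S ! j, 1)"
        "pathfinish (strand_of S j) = (bottom_points S ! j, 0)"
        "strand_of S j ` {0<..<1} \<inter> ({..1} \<times> {0..1}) = {}" if "j < card (bottom_arcs S)" for j
    using assms that by (simp_all add: partial_braid_graph_def)
  have "arc_system (num_arcs S) (card (bottom_arcs S)) (arc_of S) (strand_of S) a b (verts S)"
  proof
    show "continuous_on {0..1} (arc_of S i)" "inj_on (arc_of S i) {0..1}" if "i < num_arcs S" for i
      using differentiable_imp_continuous_on[OF diff[OF that]] rising_arc_inj[OF diff[OF that] rising[OF that]]
      by blast+
    show "strand_of S j 0 = arc_of S (a j) 1" if "j < card (bottom_arcs S)" for j
      using strands(2)[OF that] a(2)[OF that] a_top[OF that]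
      by (auto simp: pathstart_def top_arcs_def prod_eq_iff)
    show "strand_of S j 1 = arc_of S (b j) 0" if "j < card (bottom_arcs S)" for j
      using strands(3)[OF that] b(2)[OF that] b_bottom[OF that]
      by (auto simp: pathfinish_def bottom_arcs_def prod_eq_iff)
    show "strand_of S j s \<noteq> arc_of S i t"
      if "j < card (bottom_arcs S)" "i < num_arcs S" "s \<in> {0<..<1}" "t \<in> {0..1}" for i j s t
    proof
      assume eq: "strand_of S j s = arc_of S i t"
      \<comment> \<open>The arc stays in the square, which is part of the half-strip avoided by the
        interior of the strand.\<close>
      have "strand_of S j s \<in> {..1} \<times> {0..1}"
        using square[OF that(2,4)] unfolding eq by (auto simp: mem_Times_iff)
      then have "strand_of S j s \<in> strand_of S j ` {0<..<1} \<inter> {..1} \<times> {0..1}"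
        using that(3) by (intro IntI imageI)
      then show False unfolding strands(4)[OF that(1)] by simp
    qed
    show "strand_of S i ` {0..1} \<inter> strand_of S j ` {0..1} = {}"
      if "i < card (bottom_arcs S)" "j < card (bottom_arcs S)" "i \<noteq> j" for i j
      using assms that by (simp add: partial_braid_graph_def path_image_def)
    show "arc_of S i s \<in> verts S" if "i < num_arcs S" "j < num_arcs S" "i \<noteq> j" "s \<in> {0..1}" "t \<in> {0..1}"
      "arc_of S i s = arc_of S j t" for i j s t
      by (rule conjunct2[OF cross[OF that]])
    show "continuous_on {0..1} (strand_of S j)" if "j < card (bottom_arcs S)" for j
      using strands(1)[OF that] by (simp add: arc_def path_def)
    show "a j < num_arcs S" "b j < num_arcs S" if "j < card (bottom_arcs S)" for j
      using a_top[OF that] b_bottom[OF that] by (simp_all add: top_arcs_def bottom_arcs_def)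
    show "finite (verts S)" "inj_on a {..<card (bottom_arcs S)}" "inj_on b {..<card (bottom_arcs S)}"
      using fin a(1) b(1) by (simp_all add: bij_betw_def)
  qed
  then show thesis by (rule that)
qed

text \<open>The arc system of \<open>S\<close> and its reversal both count the arcs through
  \<open>p\<close>, which is why outgoing and incoming edges are equally many. Disjointness means
  that an edge leaves at most one vertex and enters at most one; it may leave and enter the same
  vertex.\<close>

lemma edges_at_vertices:
  assumes S: "partial_braid_graph S" and p: "p \<in> verts S"
  shows finite_out_edges: "finite (out_edges S p)" and finite_in_edges: "finite (in_edges S p)"
    and card_out_edges: "card (out_edges S p) = card (arcs_through S p)"
    and card_in_edges: "card (in_edges S p) = card (arcs_through S p)"
    and out_edges_disjoint: "\<lbrakk>q \<in> verts S; p \<noteq> q\<rbrakk> \<Longrightarrow> out_edges S p \<inter> out_edges S q = {}"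
    and in_edges_disjoint: "\<lbrakk>q \<in> verts S; p \<noteq> q\<rbrakk> \<Longrightarrow> in_edges S p \<inter> in_edges S q = {}"
proof -
  obtain a b where "arc_system (num_arcs S) (card (bottom_arcs S)) (arc_of S) (strand_of S) a b (verts S)"
    using arc_system_of_partial_braid_graph[OF S] .
  then interpret up: arc_system "num_arcs S" "card (bottom_arcs S)" "arc_of S" "strand_of S" a b "verts S" .
  interpret down: arc_system "num_arcs S" "card (bottom_arcs S)" "\<lambda>i t. arc_of S i (1 - t)"
    "\<lambda>j t. strand_of S j (1 - t)" b a "verts S" by (rule up.reversed)
  have reflect: "(\<lambda>t. f (1 - t)) ` T = f ` ((\<lambda>t. 1 - t) ` T)" for f :: "real \<Rightarrow> plane" and T
    by (simp add: image_image)
  have up_total: "up.total = space_of S"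
    by (simp add: up.total_def space_of_def path_image_def)
  have down_total: "down.total = space_of S"
    unfolding down.total_def reflect by (simp add: space_of_def path_image_def)
  have out: "out_edges S q = up.germs_up q" for q
    unfolding out_edges_def up.germs_up_def up_total edges_def ..
  have "(\<exists>s\<in>{0<..<1}. arc_of S i s = q \<and> (\<forall>\<^sub>F t in at_left s. arc_of S i t \<in> e)) \<longleftrightarrow>
      (\<exists>s\<in>{0<..<1}. arc_of S i (1 - s) = q \<and> (\<forall>\<^sub>F t in at_right s. arc_of S i (1 - t) \<in> e))" for i q e
  proof -
    have flip: "\<exists>s\<in>{0<..<1}. P (1 - s)" if "s \<in> {0<..<1}" "P s" for P :: "real \<Rightarrow> bool" and s
      using that by (intro bexI[of _ "1 - s"]) auto
    show ?thesis (is "(\<exists>s\<in>_. ?P s) \<longleftrightarrow> (\<exists>s\<in>_. ?Q s)")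
    proof -
      have "?Q s \<longleftrightarrow> ?P (1 - s)" for s by (simp add: eventually_at_left_reflect)
      then show ?thesis using flip[of _ ?P] flip[of _ "\<lambda>s. ?P (1 - s)"] by fastforce
    qed
  qed
  then have inn: "in_edges S q = down.germs_up q" for q
    unfolding in_edges_def down.germs_up_def down_total edges_def by simp
  have through: "{i. i < num_arcs S \<and> p \<in> arc_of S i ` {0<..<1}} = arcs_through S p"
    by (simp add: arcs_through_def)
  moreover have "(\<lambda>t. 1 - t) ` {0<..<1} = {0<..<1::real}"
    by (auto intro!: image_eqI[of _ _ "1 - _"])
  ultimately have through': "{i. i < num_arcs S \<and> p \<in> (\<lambda>t. arc_of S i (1 - t)) ` {0<..<1}} = arcs_through S p"
    unfolding reflect by (simp only:)
  have fin: "finite (arcs_through S p)" by (simp add: arcs_through_def)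
  obtain \<phi> \<psi> where bij: "bij_betw \<phi> (arcs_through S p) (out_edges S p)" "bij_betw \<psi> (arcs_through S p) (in_edges S p)"
    using up.bij_betw_germs_up[OF p] down.bij_betw_germs_up[OF p] unfolding through through' out inn by blast
  then show "finite (out_edges S p)" "finite (in_edges S p)"
    "card (out_edges S p) = card (arcs_through S p)" "card (in_edges S p) = card (arcs_through S p)"
    using fin by (simp_all add: bij_betw_finite[symmetric] bij_betw_same_card[symmetric])
  show "out_edges S p \<inter> out_edges S q = {}" "in_edges S p \<inter> in_edges S q = {}" if "q \<in> verts S" "p \<noteq> q"
    unfolding out inn using up.germs_up_disjoint down.germs_up_disjoint p that by blast+
qed

section \<open>Cancelling monic factors modulo an ideal\<close>

text \<open>This is \<open>I[X]\<close>, the kernel of reducing coefficients modulo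
  \<open>I\<close>. Congruences over the quotient ring thus become membership statements, and no
  quotient ring has to be formed. For a subring \<open>A\<close> it is the polynomial ring
  \<open>A[X]\<close>.\<close>

definition poly_ideal :: "'a::comm_ring_1 set \<Rightarrow> 'a poly set" where
  "poly_ideal I = {f. \<forall>k. coeff f k \<in> I}"

definition linear_factor :: "'a::comm_ring_1 \<Rightarrow> 'a poly" where
  "linear_factor u = [:- u, 1:]"

text \<open>The edge ring is a subset of the type of all integer polynomials, and its ideals absorb
  factors from that subset only. Working in the ambient ring type gives access to
  \<open>poly\<close>, while \<open>A\<close> records where coefficients must lie.\<close>

locale ideal_of_subring =
  fixes A I :: "'a::comm_ring_1 set"
  assumes one_A: "1 \<in> A" and add_A: "\<lbrakk>x \<in> A; y \<in> A\<rbrakk> \<Longrightarrow> x + y \<in> A"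
    and minus_A: "x \<in> A \<Longrightarrow> - x \<in> A" and mult_A: "\<lbrakk>x \<in> A; y \<in> A\<rbrakk> \<Longrightarrow> x * y \<in> A"
    and zero_I: "0 \<in> I" and add_I: "\<lbrakk>x \<in> I; y \<in> I\<rbrakk> \<Longrightarrow> x + y \<in> I"
    and mult_I: "\<lbrakk>x \<in> A; y \<in> I\<rbrakk> \<Longrightarrow> x * y \<in> I"
begin

lemma zero_A: "0 \<in> A"
  using add_A[OF one_A minus_A[OF one_A]] by simp

lemma minus_I: "x \<in> I \<Longrightarrow> - x \<in> I"
  using mult_I[OF minus_A[OF one_A], of x] by simp

lemma sum_I: "(\<And>i. i \<in> J \<Longrightarrow> f i \<in> I) \<Longrightarrow> sum f J \<in> I"
  by (induction J rule: infinite_finite_induct) (auto intro: zero_I add_I)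

lemma sum_A: "(\<And>i. i \<in> J \<Longrightarrow> f i \<in> A) \<Longrightarrow> sum f J \<in> A"
  by (induction J rule: infinite_finite_induct) (auto intro: zero_A add_A)

lemma prod_A: "(\<And>i. i \<in> J \<Longrightarrow> f i \<in> A) \<Longrightarrow> prod f J \<in> A"
  by (induction J rule: infinite_finite_induct) (auto intro: one_A mult_A)

lemma poly_ideal_add: "\<lbrakk>f \<in> poly_ideal I; g \<in> poly_ideal I\<rbrakk> \<Longrightarrow> f + g \<in> poly_ideal I"
  by (simp add: poly_ideal_def add_I)

lemma poly_ideal_mult:
  assumes "f \<in> poly_ideal A" "g \<in> poly_ideal I"
  shows "f * g \<in> poly_ideal I"
  using assms by (auto simp: poly_ideal_def coeff_mult intro!: sum_I mult_I)

lemma linear_factor_in: "u \<in> A \<Longrightarrow> linear_factor u \<in> poly_ideal A"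
  by (auto simp: poly_ideal_def linear_factor_def coeff_pCons zero_A one_A minus_A split: nat.split)

lemma poly_ideal_subring: "ideal_of_subring A A"
  by unfold_locales (fact one_A add_A minus_A mult_A zero_A)+

lemma prod_linear_factor:
  assumes "\<And>e. e \<in> E \<Longrightarrow> x e \<in> A"
  shows "(\<Prod>e\<in>E. linear_factor (x e)) \<in> poly_ideal A"
proof -
  interpret A: ideal_of_subring A A by (rule poly_ideal_subring)
  have "1 \<in> poly_ideal A" by (simp add: poly_ideal_def one_A zero_A)
  then show ?thesis using assms
    by (induction E rule: infinite_finite_induct) (auto intro!: A.poly_ideal_mult linear_factor_in)
qed

text \<open>The coefficients of \<open>f\<close> lie in \<open>I\<close> from the top downwards, because the leading coefficient
  of the linear factor is a unit.\<close>

lemma cancel_linear_factor: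
  assumes "u \<in> A" "linear_factor u * f \<in> poly_ideal I"
  shows "f \<in> poly_ideal I"
proof -
  have step: "coeff f k \<in> I" if "coeff f (Suc k) \<in> I" for k
  proof -
    have "coeff (linear_factor u * f) (Suc k) \<in> I" using assms by (simp only: poly_ideal_def mem_Collect_eq)
    then have "coeff f k - u * coeff f (Suc k) \<in> I" by (simp add: linear_factor_def)
    then have "(coeff f k - u * coeff f (Suc k)) + u * coeff f (Suc k) \<in> I"
      using mult_I[OF assms(1) that] by (intro add_I) simp_all
    then show ?thesis by simp
  qed
  \<comment> \<open>The induction counts down from \<open>Suc (degree f)\<close>, where the
    coefficient is 0.\<close>
  have "coeff f (Suc (degree f) - k) \<in> I" for k
  proof (induction k)
    case 0
    then show ?case by (simp add: coeff_eq_0 zero_I)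
  next
    case (Suc k)
    then show ?case using step[of "degree f - k"]
      by (cases "k \<le> degree f") (simp_all add: Suc_diff_le)
  qed
  then have "coeff f j \<in> I" if "j \<le> degree f" for j
    using that by (metis diff_diff_cancel le_SucI)
  moreover have "coeff f j \<in> I" if "\<not> j \<le> degree f" for j
    using that by (simp add: coeff_eq_0 zero_I)
  ultimately show ?thesis by (auto simp: poly_ideal_def)
qed

lemma cancel_prod_linear_factor:
  assumes "\<And>e. e \<in> E \<Longrightarrow> x e \<in> A" "(\<Prod>e\<in>E. linear_factor (x e)) * f \<in> poly_ideal I"
  shows "f \<in> poly_ideal I"
  using assms
proof (induction E rule: infinite_finite_induct)
  case (insert e E)
  then show ?case using cancel_linear_factor[of "x e" "(\<Prod>e\<in>E. linear_factor (x e)) * f"]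
    by (simp add: mult.assoc)
qed simp_all

text \<open>Congruences multiply. The induction also carries that the product of the
  \<open>g p\<close> lies in \<open>A[X]\<close>, because \<open>I[X]\<close> absorbs only such
  factors.\<close>

lemma prod_diff_poly_ideal:
  assumes "\<And>p. p \<in> W \<Longrightarrow> f p - g p \<in> poly_ideal I"
    and "\<And>p. p \<in> W \<Longrightarrow> f p \<in> poly_ideal A" "\<And>p. p \<in> W \<Longrightarrow> g p \<in> poly_ideal A"
  shows "(\<Prod>p\<in>W. f p) - (\<Prod>p\<in>W. g p) \<in> poly_ideal I"
proof -
  interpret A: ideal_of_subring A A by (rule poly_ideal_subring)
  have A1: "1 \<in> poly_ideal A" by (simp add: poly_ideal_def one_A zero_A)
  have "(\<Prod>p\<in>W. f p) - (\<Prod>p\<in>W. g p) \<in> poly_ideal I \<and> (\<Prod>p\<in>W. g p) \<in> poly_ideal A"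
    using assms
  proof (induction W rule: infinite_finite_induct)
    case (insert q W)
    have "f q * (\<Prod>p\<in>W. f p) - g q * (\<Prod>p\<in>W. g p) =
        f q * ((\<Prod>p\<in>W. f p) - (\<Prod>p\<in>W. g p)) + (\<Prod>p\<in>W. g p) * (f q - g q)"
      by (simp add: algebra_simps)
    then show ?case using insert
      by (auto intro!: poly_ideal_add poly_ideal_mult A.poly_ideal_mult)
  qed (simp_all add: A1, simp_all add: poly_ideal_def zero_I)
  then show ?thesis ..
qed

text \<open>Disjointness turns the product over the vertices into a product over the union of their
  edges, so an edge inside \<open>W\<close> occurs exactly once on each side. The equal numbers of
  outgoing and incoming edges give \<open>Out - In\<close> and \<open>In - Out\<close> the same
  size; hence the two constant coefficients carry the same sign.\<close>

lemma telescoping_product: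
  fixes x :: "'e \<Rightarrow> 'a"
  assumes W: "finite W"
    and fin: "\<And>p. p \<in> W \<Longrightarrow> finite (out p)" "\<And>p. p \<in> W \<Longrightarrow> finite (inn p)"
    and disj: "\<And>p q. \<lbrakk>p \<in> W; q \<in> W; p \<noteq> q\<rbrakk> \<Longrightarrow> out p \<inter> out q = {}"
      "\<And>p q. \<lbrakk>p \<in> W; q \<in> W; p \<noteq> q\<rbrakk> \<Longrightarrow> inn p \<inter> inn q = {}"
    and card: "\<And>p. p \<in> W \<Longrightarrow> card (out p) = card (inn p)"
    and x: "\<And>p e. \<lbrakk>p \<in> W; e \<in> out p \<union> inn p\<rbrakk> \<Longrightarrow> x e \<in> A"
    and local: "\<And>p. p \<in> W \<Longrightarrow> (\<Prod>e\<in>out p. linear_factor (x e)) - (\<Prod>e\<in>inn p. linear_factor (x e)) \<in> poly_ideal I"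
  shows "(\<Prod>e\<in>\<Union>(out ` W) - \<Union>(inn ` W). x e) - (\<Prod>e\<in>\<Union>(inn ` W) - \<Union>(out ` W). x e) \<in> I"
proof -
  define X where "X = (\<lambda>e. linear_factor (x e))"
  define Out where "Out = \<Union>(out ` W)"
  define In where "In = \<Union>(inn ` W)"
  have finO: "finite Out" and finI: "finite In" using W fin by (auto simp: Out_def In_def)
  have split: "prod X B = prod X (B \<inter> C) * prod X (B - C)" if "finite B" for B C
    using prod.Int_Diff[OF that] .
  have "prod X Out = (\<Prod>p\<in>W. prod X (out p))" "prod X In = (\<Prod>p\<in>W. prod X (inn p))"
    unfolding Out_def In_def using W fin disj by (intro prod.UNION_disjoint; blast)+
  moreover have "(\<Prod>p\<in>W. prod X (out p)) - (\<Prod>p\<in>W. prod X (inn p)) \<in> poly_ideal I"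
    using local x unfolding X_def by (intro prod_diff_poly_ideal prod_linear_factor) auto
  ultimately have "prod X Out - prod X In \<in> poly_ideal I" by simp
  moreover have "prod X Out - prod X In = prod X (Out \<inter> In) * (prod X (Out - In) - prod X (In - Out))"
    unfolding right_diff_distrib using split[OF finO, of In] split[OF finI, of Out]
    by (simp only: Int_commute[of In Out])
  ultimately have "(\<Prod>e\<in>Out \<inter> In. linear_factor (x e)) * (prod X (Out - In) - prod X (In - Out)) \<in> poly_ideal I"
    by (simp only: X_def)
  moreover have "x e \<in> A" if "e \<in> Out \<inter> In" for e using that x by (auto simp: Out_def)
  ultimately have "prod X (Out - In) - prod X (In - Out) \<in> poly_ideal I"
    by (rule cancel_prod_linear_factor[of "Out \<inter> In" x, rotated])
  then have "coeff (prod X (Out - In) - prod X (In - Out)) 0 \<in> I" by (simp only: poly_ideal_def mem_Collect_eq)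
  moreover have "coeff (prod X B) 0 = (- 1) ^ card B * prod x B" for B
  proof -
    have "coeff (prod X B) 0 = (\<Prod>e\<in>B. - x e)"
      unfolding poly_0_coeff_0[symmetric] poly_prod by (simp add: X_def linear_factor_def)
    then show ?thesis by (simp add: prod_uminus)
  qed
  moreover have "card (Out - In) = card (In - Out)"
  proof -
    have "card Out = (\<Sum>p\<in>W. card (out p))" "card In = (\<Sum>p\<in>W. card (inn p))"
      unfolding Out_def In_def using W fin disj by (intro card_UN_disjoint; blast)+
    then have "card Out = card In" using card by simp
    then show ?thesis using finO finI by (simp add: card_Diff_subset_Int Int_commute)
  qed
  ultimately have c: "(- 1) ^ card (Out - In) * (prod x (Out - In) - prod x (In - Out)) \<in> I" (is "?c * ?d \<in> I")
    by (simp add: algebra_simps)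
  have "?d = ?c * ?d \<or> ?d = - (?c * ?d)"
    by (cases "even (card (Out - In))") auto
  then have "?d \<in> I" using c minus_I by metis
  then show ?thesis by (simp add: Out_def In_def)
qed

end

section \<open>The ideals of a partial braid graph\<close>

lemma int_poly_ring_simps [simp]:
  "carrier (int_poly_ring V) = {f. \<forall>m\<in>Poly_Mapping.keys f. Poly_Mapping.keys m \<subseteq> V}"
  "mult (int_poly_ring V) = (*)" "one (int_poly_ring V) = 1"
  "zero (int_poly_ring V) = 0" "add (int_poly_ring V) = (+)"
  by (simp_all add: int_poly_ring_def)

lemma int_poly_ring_mult_closed:
  assumes "f \<in> carrier (int_poly_ring V)" "g \<in> carrier (int_poly_ring V)"
  shows "f * g \<in> carrier (int_poly_ring V)"
proof -
  have "Poly_Mapping.keys (a + b) \<subseteq> V" if "a \<in> Poly_Mapping.keys f" "b \<in> Poly_Mapping.keys g" for a b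
    using that assms keys_add[of a b] by fastforce
  then show ?thesis using keys_mult[of f g] by (simp add: subset_iff) blast
qed

lemma int_poly_ring_add_closed:
  assumes "f \<in> carrier (int_poly_ring V)" "g \<in> carrier (int_poly_ring V)"
  shows "f + g \<in> carrier (int_poly_ring V)"
  using assms keys_add[of f g] by (simp add: subset_iff) blast

lemma int_poly_ring_uminus_closed:
  "f \<in> carrier (int_poly_ring V) \<Longrightarrow> - f \<in> carrier (int_poly_ring V)"
  by simp

lemma cring_int_poly_ring: "cring (int_poly_ring V)"
proof (rule cringI)
  show "abelian_group (int_poly_ring V)"
  proof (rule abelian_groupI)
    fix f assume "f \<in> carrier (int_poly_ring V)"
    then show "\<exists>g\<in>carrier (int_poly_ring V). g \<oplus>\<^bsub>int_poly_ring V\<^esub> f = \<zero>\<^bsub>int_poly_ring V\<^esub>"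
      by (intro bexI[of _ "- f"] int_poly_ring_uminus_closed) simp_all
  qed (use int_poly_ring_add_closed in \<open>simp_all add: algebra_simps\<close>)
  show "Group.comm_monoid (int_poly_ring V)"
    by (rule comm_monoidI) (use int_poly_ring_mult_closed in \<open>simp_all add: algebra_simps\<close>)
qed (simp add: algebra_simps)

lemma var_in_int_poly_ring: "e \<in> V \<Longrightarrow> var e \<in> carrier (int_poly_ring V)"
  by (simp add: var_def)

lemma ideal_of_subring_int_poly_ring:
  assumes "ideal I (int_poly_ring V)"
  shows "ideal_of_subring (carrier (int_poly_ring V)) I"
proof -
  interpret ideal I "int_poly_ring V" by fact
  show ?thesis
  proof
    show "1 \<in> carrier (int_poly_ring V)" by simp
    show "0 \<in> I" using additive_subgroup.zero_closed[OF is_additive_subgroup] by simp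
    show "x + y \<in> I" if "x \<in> I" "y \<in> I" for x y
      using additive_subgroup.a_closed[OF is_additive_subgroup that] by simp
    show "x * y \<in> I" if "x \<in> carrier (int_poly_ring V)" "y \<in> I" for x y using I_l_closed[OF that(2,1)] by simp
  qed (fact int_poly_ring_add_closed int_poly_ring_mult_closed int_poly_ring_uminus_closed)+
qed

lemma cring_edge_ring: "cring (edge_ring S)"
  unfolding edge_ring_def by (rule cring_int_poly_ring)

lemma ideal_of_subring_edge_ring:
  "ideal I (edge_ring S) \<Longrightarrow> ideal_of_subring (carrier (edge_ring S)) I"
  unfolding edge_ring_def by (rule ideal_of_subring_int_poly_ring)

lemma var_in_edge_ring: "e \<in> edges S \<Longrightarrow> var e \<in> carrier (edge_ring S)"
  unfolding edge_ring_def by (rule var_in_int_poly_ring)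

lemma out_edges_subset: "out_edges S p \<subseteq> edges S" and in_edges_subset: "in_edges S p \<subseteq> edges S"
  by (auto simp: out_edges_def in_edges_def)

lemma subring_edge_ring: "ideal_of_subring (carrier (edge_ring S)) (carrier (edge_ring S))"
  by (rule ideal_of_subring_edge_ring) (rule ring.oneideal[OF cring.axioms(1)[OF cring_edge_ring]])

lemma edge_prod_closed: "B \<subseteq> edges S \<Longrightarrow> (\<Prod>e\<in>B. var e) \<in> carrier (edge_ring S)"
  by (rule ideal_of_subring.prod_A[OF subring_edge_ring]) (auto intro: var_in_edge_ring)

lemma edge_sum_closed: "B \<subseteq> edges S \<Longrightarrow> (\<Sum>e\<in>B. var e) \<in> carrier (edge_ring S)"
  by (rule ideal_of_subring.sum_A[OF subring_edge_ring]) (auto intro: var_in_edge_ring)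

lemma edge_ring_diff_closed:
  assumes "f \<in> carrier (edge_ring S)" "g \<in> carrier (edge_ring S)"
  shows "f - g \<in> carrier (edge_ring S)"
proof -
  interpret ideal_of_subring "carrier (edge_ring S)" "carrier (edge_ring S)" by (rule subring_edge_ring)
  show ?thesis using add_A[OF assms(1) minus_A[OF assms(2)]] by simp
qed

lemma generators_closed:
  "L_gen S p \<in> carrier (edge_ring S)" "Q_gen S p \<in> carrier (edge_ring S)" "N_gen S W \<in> carrier (edge_ring S)"
proof -
  show "L_gen S p \<in> carrier (edge_ring S)" "Q_gen S p \<in> carrier (edge_ring S)"
    unfolding L_gen_def Q_gen_def
    by (intro edge_ring_diff_closed edge_sum_closed edge_prod_closed out_edges_subset in_edges_subset)+
  have "\<Union>(out_edges S ` W) \<subseteq> edges S" "\<Union>(in_edges S ` W) \<subseteq> edges S"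
    using out_edges_subset in_edges_subset by blast+
  then show "N_gen S W \<in> carrier (edge_ring S)"
    unfolding N_gen_def by (intro edge_ring_diff_closed edge_prod_closed) auto
qed

lemma ideals_edge_ring:
  "ideal (L_ideal S) (edge_ring S)" "ideal (Q_ideal S) (edge_ring S)" "ideal (N_ideal S) (edge_ring S)"
  unfolding L_ideal_def Q_ideal_def N_ideal_def
  by (rule ring.genideal_ideal[OF cring.axioms(1)[OF cring_edge_ring]]; use generators_closed in blast)+

lemma generators_in_ideals:
  "four_valent S p \<Longrightarrow> L_gen S p \<in> L_ideal S" "p \<in> verts S \<Longrightarrow> Q_gen S p \<in> Q_ideal S"
  "W \<subseteq> verts S \<Longrightarrow> N_gen S W \<in> N_ideal S"
  unfolding L_ideal_def Q_ideal_def N_ideal_def genideal_def by blast+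

text \<open>A loop at \<open>p\<close> contributes its variable to both products of \<open>Q(p)\<close> but to neither product
  of \<open>N({p})\<close>.\<close>

lemma Q_gen_eq:
  assumes "partial_braid_graph S" "p \<in> verts S"
  shows "Q_gen S p = (\<Prod>e\<in>out_edges S p \<inter> in_edges S p. var e) * N_gen S {p}"
proof -
  have "(\<Prod>e\<in>out_edges S p. var e) =
      (\<Prod>e\<in>out_edges S p \<inter> in_edges S p. var e) * (\<Prod>e\<in>out_edges S p - in_edges S p. var e)"
    by (rule prod.Int_Diff[OF finite_out_edges[OF assms]])
  moreover have "(\<Prod>e\<in>in_edges S p. var e) =
      (\<Prod>e\<in>out_edges S p \<inter> in_edges S p. var e) * (\<Prod>e\<in>in_edges S p - out_edges S p. var e)"
    using prod.Int_Diff[OF finite_in_edges[OF assms], of var "out_edges S p"] by (simp only: Int_commute)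
  ultimately show ?thesis
    by (simp only: Q_gen_def N_gen_def right_diff_distrib) simp
qed

lemma Q_ideal_subset_N_ideal:
  assumes S: "partial_braid_graph S"
  shows "Q_ideal S \<subseteq> N_ideal S"
proof -
  interpret ideal_of_subring "carrier (edge_ring S)" "N_ideal S"
    by (rule ideal_of_subring_edge_ring[OF ideals_edge_ring(3)])
  have "Q_gen S p \<in> N_ideal S" if "p \<in> verts S" for p
    unfolding Q_gen_eq[OF S that]
    using that
    by (intro mult_I edge_prod_closed generators_in_ideals(3) order_trans[OF Int_lower1 out_edges_subset]) simp
  then show ?thesis unfolding Q_ideal_def
    by (intro ring.genideal_minimal[OF cring.axioms(1)[OF cring_edge_ring] ideals_edge_ring(3)]) blast
qed

text \<open>Leading terms cancel. With one factor on each side the difference is the constant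
  \<open>- Q(p)\<close>, with two it is \<open>Q(p) - L(p) X\<close>. Products over sets have two
  factors only because the two outgoing edges are distinct, and likewise the incoming ones; this is
  what the edge counts provide.\<close>

lemma vertex_relation:
  assumes S: "partial_braid_graph S" and p: "p \<in> verts S" and I: "ideal I (edge_ring S)"
    and L: "four_valent S p \<Longrightarrow> L_gen S p \<in> I" and Q: "Q_gen S p \<in> I"
  shows "(\<Prod>e\<in>out_edges S p. linear_factor (var e)) - (\<Prod>e\<in>in_edges S p. linear_factor (var e)) \<in> poly_ideal I"
proof -
  interpret ideal_of_subring "carrier (edge_ring S)" I by (rule ideal_of_subring_edge_ring[OF I])
  note cards = card_out_edges[OF S p] card_in_edges[OF S p]
  have "card (arcs_through S p) \<in> {1, 2}"
    using S p by (simp add: partial_braid_graph_def open_partial_braid_graph_def)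
  then consider "card (arcs_through S p) = 1" | "card (arcs_through S p) = 2" by blast
  then show ?thesis
  proof cases
    case 1
    then obtain e f where ef: "out_edges S p = {e}" "in_edges S p = {f}"
      using cards by (metis card_1_singletonE)
    have "linear_factor (var e) - linear_factor (var f) = [:- Q_gen S p:]"
      by (simp add: linear_factor_def Q_gen_def ef)
    then show ?thesis using minus_I[OF Q]
      by (auto simp: ef poly_ideal_def coeff_pCons zero_I split: nat.split)
  next
    case 2
    then obtain a b c d where ab: "out_edges S p = {a, b}" "a \<noteq> b" and cd: "in_edges S p = {c, d}" "c \<noteq> d"
      using cards by (metis card_2_iff)
    have "linear_factor (var a) * linear_factor (var b) - linear_factor (var c) * linear_factor (var d) =
        [:Q_gen S p, - L_gen S p:]"
      by (simp add: linear_factor_def Q_gen_def L_gen_def ab cd algebra_simps)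
    moreover have "L_gen S p \<in> I" using L 2 p by (simp add: four_valent_def)
    ultimately show ?thesis using Q minus_I[of "L_gen S p"] ab(2) cd(2)
      by (auto simp: ab(1) cd(1) poly_ideal_def coeff_pCons zero_I split: nat.split)
  qed
qed

text \<open>Any ideal containing the generators is allowed; the application is to the sum of
  \<open>L_ideal S\<close> and \<open>Q_ideal S\<close>.\<close>

lemma N_gen_in_ideal:
  assumes S: "partial_braid_graph S" and I: "ideal I (edge_ring S)"
    and L: "\<And>p. four_valent S p \<Longrightarrow> L_gen S p \<in> I" and Q: "\<And>p. p \<in> verts S \<Longrightarrow> Q_gen S p \<in> I"
    and W: "W \<subseteq> verts S"
  shows "N_gen S W \<in> I"
proof -
  interpret ideal_of_subring "carrier (edge_ring S)" I by (rule ideal_of_subring_edge_ring[OF I])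
  have "finite (verts S)" using S by (simp add: partial_braid_graph_def open_partial_braid_graph_def)
  then have fin: "finite W" using W finite_subset by blast
  have V: "p \<in> verts S" if "p \<in> W" for p using that W by blast
  show ?thesis unfolding N_gen_def
  proof (rule telescoping_product[OF fin])
    fix p assume p: "p \<in> W"
    show "finite (out_edges S p)" "finite (in_edges S p)" "card (out_edges S p) = card (in_edges S p)"
      using edges_at_vertices(1-4)[OF S V[OF p]] by simp_all
    show "(\<Prod>e\<in>out_edges S p. linear_factor (var e)) - (\<Prod>e\<in>in_edges S p. linear_factor (var e)) \<in> poly_ideal I"
      by (rule vertex_relation[OF S V[OF p] I L Q[OF V[OF p]]])
    show "var e \<in> carrier (edge_ring S)" if "e \<in> out_edges S p \<union> in_edges S p" for e
      using that out_edges_subset[of S p] in_edges_subset[of S p] var_in_edge_ring by blast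
    fix q assume "q \<in> W" "p \<noteq> q"
    then show "out_edges S p \<inter> out_edges S q = {}" "in_edges S p \<inter> in_edges S q = {}"
      using edges_at_vertices(5,6)[OF S V[OF p] V] by blast+
  qed
qed

lemma L_plus_N_eq_L_plus_Q:
  assumes S: "partial_braid_graph S"
  shows "L_ideal S <+>\<^bsub>edge_ring S\<^esub> N_ideal S = L_ideal S <+>\<^bsub>edge_ring S\<^esub> Q_ideal S"
proof
  let ?R = "edge_ring S"
  interpret R: cring ?R by (rule cring_edge_ring)
  let ?I = "L_ideal S <+>\<^bsub>?R\<^esub> Q_ideal S"
  have I: "ideal ?I ?R" by (rule R.add_ideals[OF ideals_edge_ring(1,2)])
  interpret I: ideal ?I ?R by (rule I)
  have zero: "\<zero>\<^bsub>?R\<^esub> \<in> L_ideal S" "\<zero>\<^bsub>?R\<^esub> \<in> Q_ideal S"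
    using ideals_edge_ring[of S] by (simp_all add: ideal_def additive_subgroup.zero_closed)
  have sub: "L_ideal S \<subseteq> carrier ?R" "Q_ideal S \<subseteq> carrier ?R"
    using ideals_edge_ring[of S] by (simp_all add: ideal_def additive_subgroup.a_subset)
  have sum: "l \<oplus>\<^bsub>?R\<^esub> q \<in> ?I" if "l \<in> L_ideal S" "q \<in> Q_ideal S" for l q
    using that unfolding set_add_def' by blast
  have LQ: "L_ideal S \<subseteq> ?I" "Q_ideal S \<subseteq> ?I"
  proof
    show "l \<in> ?I" if "l \<in> L_ideal S" for l
      using sum[OF that zero(2)] subsetD[OF sub(1) that] by (simp only: R.r_zero)
    show "Q_ideal S \<subseteq> ?I"
    proof
      show "q \<in> ?I" if "q \<in> Q_ideal S" for q
        using sum[OF zero(1) that] subsetD[OF sub(2) that] by (simp only: R.l_zero)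
    qed
  qed
  then have "N_gen S W \<in> ?I" if "W \<subseteq> verts S" for W
    using generators_in_ideals that by (intro N_gen_in_ideal[OF S I]) blast+
  then have "N_ideal S \<subseteq> ?I" unfolding N_ideal_def
    by (intro R.genideal_minimal[OF I]) blast
  with LQ(1) show "L_ideal S <+>\<^bsub>?R\<^esub> N_ideal S \<subseteq> ?I"
    unfolding set_add_def'[of _ "L_ideal S" "N_ideal S"] using I.a_closed by blast
  show "?I \<subseteq> L_ideal S <+>\<^bsub>?R\<^esub> N_ideal S"
    using Q_ideal_subset_N_ideal[OF S] unfolding set_add_def' by blast
qed

section \<open>Quotients of modules\<close>

lemma (in abelian_group) minus_zero_eq: "x \<in> carrier G \<Longrightarrow> x \<ominus> \<zero> = x"
  using minus_equality[of \<zero> \<zero>] by (simp add: a_minus_def)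

lemma (in abelian_group) minus_eq_zero_iff:
  assumes "x \<in> carrier G" "y \<in> carrier G"
  shows "x \<ominus> y = \<zero> \<longleftrightarrow> x = y"
proof
  assume "x \<ominus> y = \<zero>"
  then have "\<ominus> (\<ominus> y) = x" using assms by (intro minus_equality) (simp_all add: a_minus_def)
  then show "x = y" using assms by simp
qed (use assms in \<open>simp add: a_minus_def r_neg\<close>)

section \<open>Homomorphisms and isomorphisms of modules\<close>

lemma module_homD:
  assumes "h \<in> module_hom R M N"
  shows "x \<in> carrier M \<Longrightarrow> h x \<in> carrier N"
    and "\<lbrakk>x \<in> carrier M; y \<in> carrier M\<rbrakk> \<Longrightarrow> h (x \<oplus>\<^bsub>M\<^esub> y) = h x \<oplus>\<^bsub>N\<^esub> h y"
    and "\<lbrakk>a \<in> carrier R; x \<in> carrier M\<rbrakk> \<Longrightarrow> h (a \<odot>\<^bsub>M\<^esub> x) = a \<odot>\<^bsub>N\<^esub> h x"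
  using assms by (auto simp: module_hom_def)

lemma module_homI:
  assumes "\<And>x. x \<in> carrier M \<Longrightarrow> h x \<in> carrier N"
    and "\<And>x y. \<lbrakk>x \<in> carrier M; y \<in> carrier M\<rbrakk> \<Longrightarrow> h (x \<oplus>\<^bsub>M\<^esub> y) = h x \<oplus>\<^bsub>N\<^esub> h y"
    and "\<And>a x. \<lbrakk>a \<in> carrier R; x \<in> carrier M\<rbrakk> \<Longrightarrow> h (a \<odot>\<^bsub>M\<^esub> x) = a \<odot>\<^bsub>N\<^esub> h x"
  shows "h \<in> module_hom R M N"
  using assms by (auto simp: module_hom_def)

lemma module_hom_zero:
  assumes "module R M" "module R N" "h \<in> module_hom R M N"
  shows "h \<zero>\<^bsub>M\<^esub> = \<zero>\<^bsub>N\<^esub>"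
proof -
  interpret M: module R M by fact
  interpret N: module R N by fact
  have "h (\<zero>\<^bsub>R\<^esub> \<odot>\<^bsub>M\<^esub> \<zero>\<^bsub>M\<^esub>) = \<zero>\<^bsub>R\<^esub> \<odot>\<^bsub>N\<^esub> h \<zero>\<^bsub>M\<^esub>"
    by (rule module_homD(3)[OF assms(3)]) simp_all
  then show ?thesis using module_homD(1)[OF assms(3), of "\<zero>\<^bsub>M\<^esub>"] by simp
qed

lemma module_hom_minus:
  assumes "module R M" "module R N" "h \<in> module_hom R M N" "x \<in> carrier M" "y \<in> carrier M"
  shows "h (x \<ominus>\<^bsub>M\<^esub> y) = h x \<ominus>\<^bsub>N\<^esub> h y"
proof -
  interpret M: module R M by fact
  interpret N: module R N by fact
  note h = module_homD[OF assms(3)]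
  \<comment> \<open>Negation is multiplication by the scalar -1, which a homomorphism respects by
    definition.\<close>
  have neg: "\<ominus>\<^bsub>M\<^esub> y = (\<ominus>\<^bsub>R\<^esub> \<one>\<^bsub>R\<^esub>) \<odot>\<^bsub>M\<^esub> y"
    using assms by (simp add: M.smult_l_minus)
  have "h (\<ominus>\<^bsub>M\<^esub> y) = \<ominus>\<^bsub>N\<^esub> h y"
    using assms h(1) unfolding neg by (simp add: h(3) N.smult_l_minus)
  then show ?thesis using assms h(1) by (simp add: a_minus_def h(2))
qed

lemma module_hom_comp:
  "\<lbrakk>f \<in> module_hom R M N; g \<in> module_hom R N N'\<rbrakk> \<Longrightarrow> (\<lambda>x. g (f x)) \<in> module_hom R M N'"
  by (auto simp: module_hom_def Pi_iff)

lemma module_isomorphic_sym: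
  assumes "module R M" "module_isomorphic R M N"
  shows "module_isomorphic R N M"
proof -
  interpret module R M by fact
  obtain h where h: "h \<in> module_hom R M N" and bij: "bij_betw h (carrier M) (carrier N)"
    using assms(2) by (auto simp: module_isomorphic_def)
  let ?g = "inv_into (carrier M) h"
  have bij': "bij_betw ?g (carrier N) (carrier M)" by (rule bij_betw_inv_into[OF bij])
  then have mem: "?g x \<in> carrier M" if "x \<in> carrier N" for x using that by (rule bij_betwE[rule_format])
  have hg: "h (?g x) = x" if "x \<in> carrier N" for x
    using that bij by (simp add: bij_betw_inv_into_right)
  have gh: "?g (h x) = x" if "x \<in> carrier M" for x
    using that bij by (simp add: bij_betw_inv_into_left)
  have "?g \<in> module_hom R N M"
  proof (rule module_homI)
    show "?g (x \<oplus>\<^bsub>N\<^esub> y) = ?g x \<oplus>\<^bsub>M\<^esub> ?g y" if "x \<in> carrier N" "y \<in> carrier N" for x y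
      using gh[of "?g x \<oplus>\<^bsub>M\<^esub> ?g y"] mem that by (simp add: module_homD(2)[OF h] hg)
    show "?g (a \<odot>\<^bsub>N\<^esub> x) = a \<odot>\<^bsub>M\<^esub> ?g x" if "a \<in> carrier R" "x \<in> carrier N" for a x
      using gh[of "a \<odot>\<^bsub>M\<^esub> ?g x"] mem that by (simp add: module_homD(3)[OF h] hg)
  qed (rule mem)
  then show ?thesis using bij' by (auto simp: module_isomorphic_def)
qed

lemma module_isomorphic_trans:
  assumes "module_isomorphic R M N" "module_isomorphic R N N'"
  shows "module_isomorphic R M N'"
proof -
  obtain f g where "f \<in> module_hom R M N" "bij_betw f (carrier M) (carrier N)"
    "g \<in> module_hom R N N'" "bij_betw g (carrier N) (carrier N')"
    using assms by (auto simp: module_isomorphic_def)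
  then have "g \<circ> f \<in> module_hom R M N'" "bij_betw (g \<circ> f) (carrier M) (carrier N')"
    using module_hom_comp[of f R M N g N'] by (auto simp: comp_def intro: bij_betw_trans[unfolded comp_def])
  then show ?thesis by (auto simp: module_isomorphic_def)
qed

section \<open>Quotient modules and the first isomorphism theorem\<close>

locale module_quotient = module R M for R :: "'r ring" (structure) and M :: "('r, 'a) module" (structure) +
  fixes H :: "'a set"
  assumes sub: "submodule H R M"
begin

sublocale abelian_subgroup H M
  using abelian_subgroupI3[OF additive_subgroupI[OF submodule.axioms(1)[OF sub]]] module.axioms(2)[OF module_axioms] .

lemma carrier_quotient: "carrier (quotient_module M H) = (\<lambda>x. H +>\<^bsub>M\<^esub> x) ` carrier M"
  by (auto simp: quotient_module_def A_RCOSETS_def')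

lemma add_quotient:
  "\<lbrakk>x \<in> carrier M; y \<in> carrier M\<rbrakk> \<Longrightarrow>
    (H +>\<^bsub>M\<^esub> x) \<oplus>\<^bsub>quotient_module M H\<^esub> (H +>\<^bsub>M\<^esub> y) = H +>\<^bsub>M\<^esub> (x \<oplus>\<^bsub>M\<^esub> y)"
  by (simp add: quotient_module_def a_rcos_sum)

lemma coset_zero: "H +>\<^bsub>M\<^esub> \<zero>\<^bsub>M\<^esub> = H"
  by (rule a_rcos_const) (rule zero_closed)

lemma zero_quotient: "\<zero>\<^bsub>quotient_module M H\<^esub> = H +>\<^bsub>M\<^esub> \<zero>\<^bsub>M\<^esub>"
  by (simp add: quotient_module_def coset_zero)

lemma coset_eq_iff:
  assumes "x \<in> carrier M" "y \<in> carrier M"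
  shows "H +>\<^bsub>M\<^esub> x = H +>\<^bsub>M\<^esub> y \<longleftrightarrow> x \<ominus>\<^bsub>M\<^esub> y \<in> H"
proof -
  have "H +>\<^bsub>M\<^esub> x = H +>\<^bsub>M\<^esub> y \<longleftrightarrow> x \<in> H +>\<^bsub>M\<^esub> y"
    using assms a_repr_independence'[of x y] a_rcos_self[of x] by auto
  then show ?thesis using assms by (simp add: a_rcos_module a_minus_def)
qed

text \<open>The scalar action is defined as a union over all representatives. They differ by
  elements of \<open>H\<close>, and \<open>H\<close> is closed under scalars, so the union collapses
  to one coset.\<close>

lemma smult_quotient:
  assumes "a \<in> carrier R" "x \<in> carrier M"
  shows "a \<odot>\<^bsub>quotient_module M H\<^esub> (H +>\<^bsub>M\<^esub> x) = H +>\<^bsub>M\<^esub> (a \<odot>\<^bsub>M\<^esub> x)"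
proof -
  have eq: "H +>\<^bsub>M\<^esub> (a \<odot>\<^bsub>M\<^esub> y) = H +>\<^bsub>M\<^esub> (a \<odot>\<^bsub>M\<^esub> x)" if "y \<in> H +>\<^bsub>M\<^esub> x" for y
  proof -
    have y: "y \<in> carrier M" using a_elemrcos_carrier[OF assms(2) that] .
    have "y \<ominus>\<^bsub>M\<^esub> x \<in> H" using that assms y by (simp add: a_rcos_module a_minus_def)
    then have "a \<odot>\<^bsub>M\<^esub> (y \<ominus>\<^bsub>M\<^esub> x) \<in> H" using submodule.smult_closed[OF sub assms(1)] by simp
    then show ?thesis
      using assms y by (simp add: coset_eq_iff a_minus_def smult_r_distr smult_r_minus)
  qed
  have "(\<Union>y\<in>H +>\<^bsub>M\<^esub> x. H +>\<^bsub>M\<^esub> (a \<odot>\<^bsub>M\<^esub> y)) = (\<Union>y\<in>H +>\<^bsub>M\<^esub> x. H +>\<^bsub>M\<^esub> (a \<odot>\<^bsub>M\<^esub> x))"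
    by (rule SUP_cong[OF refl eq])
  also have "\<dots> = H +>\<^bsub>M\<^esub> (a \<odot>\<^bsub>M\<^esub> x)"
    using a_rcos_self[OF assms(2)] by blast
  finally show ?thesis by (simp add: quotient_module_def)
qed

lemma module_quotient_module: "module R (quotient_module M H)"
proof (rule moduleI)
  let ?Q = "quotient_module M H"
  note q = carrier_quotient add_quotient zero_quotient smult_quotient
  show "cring R" by (rule R.is_cring)
  show "abelian_group ?Q"
  proof (rule abelian_groupI)
    show "\<exists>Y\<in>carrier ?Q. Y \<oplus>\<^bsub>?Q\<^esub> X = \<zero>\<^bsub>?Q\<^esub>" if X: "X \<in> carrier ?Q" for X
    proof -
      obtain x where x: "x \<in> carrier M" "X = H +>\<^bsub>M\<^esub> x" using X by (auto simp: q)
      have "(H +>\<^bsub>M\<^esub> \<ominus>\<^bsub>M\<^esub> x) \<oplus>\<^bsub>?Q\<^esub> X = \<zero>\<^bsub>?Q\<^esub>"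
        using x by (simp add: q M.l_neg)
      then show ?thesis using x by (auto simp: carrier_quotient)
    qed
    show "X \<oplus>\<^bsub>?Q\<^esub> Y \<in> carrier ?Q" if "X \<in> carrier ?Q" "Y \<in> carrier ?Q" for X Y
      using that by (auto simp: q)
    show "X \<oplus>\<^bsub>?Q\<^esub> Y \<oplus>\<^bsub>?Q\<^esub> Z = X \<oplus>\<^bsub>?Q\<^esub> (Y \<oplus>\<^bsub>?Q\<^esub> Z)"
      if "X \<in> carrier ?Q" "Y \<in> carrier ?Q" "Z \<in> carrier ?Q" for X Y Z
      using that by (auto simp: q M.a_assoc)
    show "X \<oplus>\<^bsub>?Q\<^esub> Y = Y \<oplus>\<^bsub>?Q\<^esub> X" if "X \<in> carrier ?Q" "Y \<in> carrier ?Q" for X Y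
      using that by (auto simp: q M.a_comm)
  qed (auto simp: q)
qed (auto simp: carrier_quotient add_quotient smult_quotient smult_l_distr smult_r_distr smult_assoc1)

text \<open>The value is taken at a chosen representative; another choice changes it by an element
  of \<open>H\<close>, which \<open>f\<close> sends to zero.\<close>

lemma quotient_lift:
  assumes N: "module R N" and f: "f \<in> module_hom R M N" and null: "\<And>x. x \<in> H \<Longrightarrow> f x = \<zero>\<^bsub>N\<^esub>"
  shows "\<exists>h\<in>module_hom R (quotient_module M H) N. \<forall>x\<in>carrier M. h (H +>\<^bsub>M\<^esub> x) = f x"
proof -
  interpret N: module R N by (rule N)
  define h where "h X = f (SOME x. x \<in> X)" for X
  have h: "h (H +>\<^bsub>M\<^esub> x) = f x" if x: "x \<in> carrier M" for x
  proof -
    let ?y = "SOME y. y \<in> H +>\<^bsub>M\<^esub> x"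
    have y: "?y \<in> H +>\<^bsub>M\<^esub> x" using a_rcos_self[OF x] by (rule someI)
    then have y': "?y \<in> carrier M" by (rule a_elemrcos_carrier[OF x])
    have "?y \<ominus>\<^bsub>M\<^esub> x \<in> H" using y x y' by (simp add: a_rcos_module a_minus_def)
    then have "f ?y \<ominus>\<^bsub>N\<^esub> f x = \<zero>\<^bsub>N\<^esub>"
      using null module_hom_minus[OF module_axioms N f y' x] by simp
    then show ?thesis unfolding h_def
      using module_homD(1)[OF f x] module_homD(1)[OF f y'] N.minus_eq_zero_iff by blast
  qed
  have "h \<in> module_hom R (quotient_module M H) N"
    by (rule module_homI)
      (auto simp: carrier_quotient add_quotient smult_quotient h module_homD[OF f])
  then show ?thesis using h by blast
qed

end

lemma submodule_kernel:
  assumes "module R M" "module R N" "f \<in> module_hom R M N"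
  shows "submodule (hom_kernel M N f) R M"
proof -
  interpret M: module R M by fact
  interpret N: module R N by fact
  note f = module_homD[OF assms(3)] module_hom_zero[OF assms]
  show ?thesis
  proof (rule M.submoduleI)
    show "\<ominus>\<^bsub>M\<^esub> x \<in> hom_kernel M N f" if "x \<in> hom_kernel M N f" for x
      using that module_hom_minus[OF assms, of "\<zero>\<^bsub>M\<^esub>" x] f(4) by (simp add: hom_kernel_def a_minus_def)
  qed (auto simp: hom_kernel_def f)
qed

lemma first_isomorphism:
  assumes M: "module R M" and N: "module R N" and f: "f \<in> module_hom R M N" and surj: "f ` carrier M = carrier N"
  shows "module_isomorphic R (quotient_module M (hom_kernel M N f)) N"
proof -
  let ?H = "hom_kernel M N f"
  have Q: "module_quotient R M ?H"
    by (intro module_quotient.intro module_quotient_axioms.intro M submodule_kernel[OF M N f])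
  interpret M: abelian_group M by (rule module.axioms(2)[OF M])
  interpret N: abelian_group N by (rule module.axioms(2)[OF N])
  have null: "f x = \<zero>\<^bsub>N\<^esub>" if "x \<in> ?H" for x
    using that by (simp add: hom_kernel_def)
  obtain h where h: "h \<in> module_hom R (quotient_module M ?H) N" "\<And>x. x \<in> carrier M \<Longrightarrow> h (?H +>\<^bsub>M\<^esub> x) = f x"
    using module_quotient.quotient_lift[OF Q N f null] by blast
  have "inj_on h (carrier (quotient_module M ?H))"
  proof (rule inj_onI)
    fix X Y assume "X \<in> carrier (quotient_module M ?H)" "Y \<in> carrier (quotient_module M ?H)" and eq: "h X = h Y"
    then obtain x y where x: "x \<in> carrier M" "X = ?H +>\<^bsub>M\<^esub> x" and y: "y \<in> carrier M" "Y = ?H +>\<^bsub>M\<^esub> y"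
      by (auto simp: module_quotient.carrier_quotient[OF Q])
    then have "f x = f y" using eq by (simp add: h)
    then have "f (x \<ominus>\<^bsub>M\<^esub> y) = \<zero>\<^bsub>N\<^esub>"
      using x y module_homD(1)[OF f] by (simp add: module_hom_minus[OF M N f] N.minus_eq_zero_iff)
    then show "X = Y" using x y by (simp add: module_quotient.coset_eq_iff[OF Q]) (simp add: hom_kernel_def M.minus_closed)
  qed
  moreover have "h ` carrier (quotient_module M ?H) = carrier N"
    unfolding surj[symmetric] using h(2) by (simp add: module_quotient.carrier_quotient[OF Q] image_image)
  ultimately show ?thesis using h(1) by (auto simp: module_isomorphic_def bij_betw_def)
qed

lemma submodule_generated:
  assumes "module R M" "X \<subseteq> carrier M"
  shows "submodule (generated_submodule R M X) R M" "X \<subseteq> generated_submodule R M X"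
proof -
  interpret module R M by fact
  \<comment> \<open>The whole module belongs to the intersected family, so the intersection stays
    inside the carrier.\<close>
  have c: "submodule (carrier M) R M" by (rule carrier_is_submodule)
  show "X \<subseteq> generated_submodule R M X" by (auto simp: generated_submodule_def)
  show "submodule (generated_submodule R M X) R M"
  proof (rule submoduleI)
    show "generated_submodule R M X \<subseteq> carrier M"
      using c assms(2) by (auto simp: generated_submodule_def)
    show "\<zero>\<^bsub>M\<^esub> \<in> generated_submodule R M X"
      using subgroup.one_closed[OF submodule.axioms(1)] by (auto simp: generated_submodule_def)
  qed (auto simp: generated_submodule_def intro: submoduleE(3,4,5))
qed

lemma generated_submodule_minimal:
  "\<lbrakk>submodule H R M; X \<subseteq> H\<rbrakk> \<Longrightarrow> generated_submodule R M X \<subseteq> H"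
  by (auto simp: generated_submodule_def)

section \<open>Free modules\<close>

context
  fixes R :: "'r ring" (structure)
  assumes cring: "cring R"
begin

interpretation cring R by (rule cring)

lemma carrier_free:
  "f \<in> carrier (free_module R X) \<longleftrightarrow>
     (\<forall>x. f x \<in> carrier R) \<and> finite {x. f x \<noteq> \<zero>} \<and> {x. f x \<noteq> \<zero>} \<subseteq> X"
  by (auto simp: free_module_def)

lemma free_simps:
  "\<zero>\<^bsub>free_module R X\<^esub> = (\<lambda>_. \<zero>)" "f \<oplus>\<^bsub>free_module R X\<^esub> g = (\<lambda>x. f x \<oplus> g x)"
  "a \<odot>\<^bsub>free_module R X\<^esub> f = (\<lambda>x. a \<otimes> f x)"
  by (simp_all add: free_module_def)

lemma free_add_closed:
  assumes f: "f \<in> carrier (free_module R X)" and g: "g \<in> carrier (free_module R X)"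
  shows "f \<oplus>\<^bsub>free_module R X\<^esub> g \<in> carrier (free_module R X)"
proof -
  have "{x. f x \<oplus> g x \<noteq> \<zero>} \<subseteq> {x. f x \<noteq> \<zero>} \<union> {x. g x \<noteq> \<zero>}" by auto
  moreover have "finite ({x. f x \<noteq> \<zero>} \<union> {x. g x \<noteq> \<zero>})" using f g by (simp add: carrier_free)
  ultimately show ?thesis using f g finite_subset by (auto simp: carrier_free free_simps)
qed

lemma free_smult_closed:
  assumes a: "a \<in> carrier R" and f: "f \<in> carrier (free_module R X)"
  shows "a \<odot>\<^bsub>free_module R X\<^esub> f \<in> carrier (free_module R X)"
proof -
  have "{x. a \<otimes> f x \<noteq> \<zero>} \<subseteq> {x. f x \<noteq> \<zero>}" using a by auto
  moreover have "finite {x. f x \<noteq> \<zero>}" using f by (simp add: carrier_free)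
  ultimately show ?thesis using a f finite_subset by (auto simp: carrier_free free_simps)
qed

lemma module_free: "module R (free_module R X)"
proof (rule moduleI)
  let ?F = "free_module R X"
  show "abelian_group ?F"
  proof (rule abelian_groupI)
    show "\<exists>g\<in>carrier ?F. g \<oplus>\<^bsub>?F\<^esub> f = \<zero>\<^bsub>?F\<^esub>" if "f \<in> carrier ?F" for f
    proof
      \<comment> \<open>The multiple by -1 serves as the negative, so that finite support comes from
        \<open>free_smult_closed\<close>.\<close>
      show "(\<ominus> \<one>) \<odot>\<^bsub>?F\<^esub> f \<in> carrier ?F" using that by (intro free_smult_closed) simp
      show "(\<ominus> \<one>) \<odot>\<^bsub>?F\<^esub> f \<oplus>\<^bsub>?F\<^esub> f = \<zero>\<^bsub>?F\<^esub>"
        using that by (auto simp: free_simps carrier_free l_minus l_neg)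
    qed
    show "f \<oplus>\<^bsub>?F\<^esub> g \<oplus>\<^bsub>?F\<^esub> h = f \<oplus>\<^bsub>?F\<^esub> (g \<oplus>\<^bsub>?F\<^esub> h)"
      if "f \<in> carrier ?F" "g \<in> carrier ?F" "h \<in> carrier ?F" for f g h
      using that by (simp add: carrier_free free_simps a_assoc)
    show "f \<oplus>\<^bsub>?F\<^esub> g = g \<oplus>\<^bsub>?F\<^esub> f" if "f \<in> carrier ?F" "g \<in> carrier ?F" for f g
      using that by (simp add: carrier_free free_simps a_comm)
    show "\<zero>\<^bsub>?F\<^esub> \<oplus>\<^bsub>?F\<^esub> f = f" if "f \<in> carrier ?F" for f
      using that by (simp add: carrier_free free_simps)
  qed (use free_add_closed in \<open>simp_all add: carrier_free free_simps(1)\<close>)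
qed (use free_smult_closed is_cring in \<open>auto simp: carrier_free free_simps l_distr r_distr m_assoc\<close>)

lemma free_gen_closed: "x \<in> X \<Longrightarrow> free_gen R x \<in> carrier (free_module R X)"
  by (auto simp: carrier_free free_gen_def intro: finite_subset[of _ "{x}"])

text \<open>Induction on a finite set containing the support: clearing the value at one point splits
  off one multiple of a generator.\<close>

lemma free_induct:
  assumes f: "f \<in> carrier (free_module R X)" and zero: "P \<zero>\<^bsub>free_module R X\<^esub>"
    and step: "\<And>f a x. \<lbrakk>f \<in> carrier (free_module R X); a \<in> carrier R; x \<in> X; P f\<rbrakk> \<Longrightarrow>
       P (f \<oplus>\<^bsub>free_module R X\<^esub> a \<odot>\<^bsub>free_module R X\<^esub> free_gen R x)"
  shows "P f"
proof -
  have "finite A \<Longrightarrow> f \<in> carrier (free_module R X) \<Longrightarrow> {x. f x \<noteq> \<zero>} \<subseteq> A \<Longrightarrow> P f" for A f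
  proof (induction A arbitrary: f rule: finite_induct)
    case empty
    then have "f = \<zero>\<^bsub>free_module R X\<^esub>" by (auto simp: free_simps)
    then show ?case using zero by simp
  next
    case (insert x A)
    show ?case
    proof (cases "f x = \<zero>")
      case True
      then show ?thesis using insert by (intro insert.IH) auto
    next
      case False
      let ?g = "f(x := \<zero>)"
      have x: "x \<in> X" "f x \<in> carrier R" using False insert.prems(1) by (auto simp: carrier_free)
      have "{y. ?g y \<noteq> \<zero>} \<subseteq> {y. f y \<noteq> \<zero>}" by auto
      then have "finite {y. ?g y \<noteq> \<zero>}"
        by (rule finite_subset) (use insert.prems(1) in \<open>simp add: carrier_free\<close>)
      then have g: "?g \<in> carrier (free_module R X)"
        using insert.prems(1) by (auto simp: carrier_free)
      have "P ?g" using insert.prems(2) by (intro insert.IH g) auto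
      then have "P (?g \<oplus>\<^bsub>free_module R X\<^esub> f x \<odot>\<^bsub>free_module R X\<^esub> free_gen R x)"
        using g x by (intro step)
      moreover have "?g \<oplus>\<^bsub>free_module R X\<^esub> f x \<odot>\<^bsub>free_module R X\<^esub> free_gen R x = f"
        using insert.prems(1) by (auto simp: free_simps free_gen_def carrier_free fun_eq_iff)
      ultimately show ?thesis by simp
    qed
  qed
  from this[of "{x. f x \<noteq> \<zero>}" f] show ?thesis using f by (simp add: carrier_free)
qed

lemma free_lift:
  assumes M: "module R M" and \<phi>: "\<And>x. x \<in> X \<Longrightarrow> \<phi> x \<in> carrier M"
  shows "\<exists>h\<in>module_hom R (free_module R X) M. \<forall>x\<in>X. h (free_gen R x) = \<phi> x"
proof -
  interpret M: module R M by (rule M)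
  define h where "h f = (\<Oplus>\<^bsub>M\<^esub>x\<in>{x. f x \<noteq> \<zero>}. f x \<odot>\<^bsub>M\<^esub> \<phi> x)" for f
  let ?F = "free_module R X"
  have closed: "f x \<odot>\<^bsub>M\<^esub> \<phi> x \<in> carrier M" if "f \<in> carrier ?F" "x \<in> X" for f x
    using that \<phi> by (auto simp: carrier_free)
  \<comment> \<open>Any finite index set between the support and \<open>X\<close> gives the same
    sum, so two elements can be added over a common index set. The bound \<open>X\<close> matters
    because \<open>\<phi>\<close> is controlled only there.\<close>
  have h_eq: "h f = (\<Oplus>\<^bsub>M\<^esub>x\<in>A. f x \<odot>\<^bsub>M\<^esub> \<phi> x)"
    if "f \<in> carrier ?F" "finite A" "{x. f x \<noteq> \<zero>} \<subseteq> A" "A \<subseteq> X" for f A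
    unfolding h_def using that closed \<phi>
    by (intro M.add.finprod_mono_neutral_cong_left) auto
  have "h \<in> module_hom R ?F M"
  proof (rule module_homI)
    show "h f \<in> carrier M" if "f \<in> carrier ?F" for f
      using that closed unfolding h_def by (intro M.finsum_closed) (auto simp: carrier_free)
    show "h (f \<oplus>\<^bsub>?F\<^esub> g) = h f \<oplus>\<^bsub>M\<^esub> h g" if f: "f \<in> carrier ?F" and g: "g \<in> carrier ?F" for f g
    proof -
      let ?A = "{x. f x \<noteq> \<zero>} \<union> {x. g x \<noteq> \<zero>}"
      have A: "finite ?A" "?A \<subseteq> X" using f g by (auto simp: carrier_free)
      have "{x. f x \<oplus> g x \<noteq> \<zero>} \<subseteq> ?A" by auto
      then have "h (f \<oplus>\<^bsub>?F\<^esub> g) = (\<Oplus>\<^bsub>M\<^esub>x\<in>?A. (f x \<oplus> g x) \<odot>\<^bsub>M\<^esub> \<phi> x)"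
        using h_eq[OF free_add_closed[OF f g] A(1) _ A(2)] by (simp only: free_simps)
      also have "\<dots> = (\<Oplus>\<^bsub>M\<^esub>x\<in>?A. f x \<odot>\<^bsub>M\<^esub> \<phi> x \<oplus>\<^bsub>M\<^esub> g x \<odot>\<^bsub>M\<^esub> \<phi> x)"
        using f g A \<phi> closed by (intro M.finsum_cong') (auto simp: carrier_free M.smult_l_distr subset_iff)
      also have "\<dots> = h f \<oplus>\<^bsub>M\<^esub> h g"
        using h_eq[OF f A(1) _ A(2)] h_eq[OF g A(1) _ A(2)] A closed[OF f] closed[OF g]
        by (subst M.finsum_addf) auto
      finally show ?thesis .
    qed
    show "h (a \<odot>\<^bsub>?F\<^esub> f) = a \<odot>\<^bsub>M\<^esub> h f" if a: "a \<in> carrier R" and f: "f \<in> carrier ?F" for a f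
    proof -
      let ?A = "{x. f x \<noteq> \<zero>}"
      have A: "finite ?A" "?A \<subseteq> X" using f by (auto simp: carrier_free)
      have "{x. a \<otimes> f x \<noteq> \<zero>} \<subseteq> ?A" using a by auto
      then have "h (a \<odot>\<^bsub>?F\<^esub> f) = (\<Oplus>\<^bsub>M\<^esub>x\<in>?A. (a \<otimes> f x) \<odot>\<^bsub>M\<^esub> \<phi> x)"
        using h_eq[OF free_smult_closed[OF a f] A(1) _ A(2)] by (simp only: free_simps)
      also have "\<dots> = (\<Oplus>\<^bsub>M\<^esub>x\<in>?A. a \<odot>\<^bsub>M\<^esub> (f x \<odot>\<^bsub>M\<^esub> \<phi> x))"
        using a f A \<phi> closed by (intro M.finsum_cong') (auto simp: carrier_free M.smult_assoc1 subset_iff)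
      also have "\<dots> = a \<odot>\<^bsub>M\<^esub> h f"
        unfolding h_def using A a closed[OF f] by (intro M.finsum_smult_ldistr[symmetric]) auto
      finally show ?thesis .
    qed
  qed
  moreover have "h (free_gen R x) = \<phi> x" if "x \<in> X" for x
  proof -
    have "h (free_gen R x) = (\<Oplus>\<^bsub>M\<^esub>y\<in>{x}. free_gen R x y \<odot>\<^bsub>M\<^esub> \<phi> y)"
      using that by (intro h_eq free_gen_closed) (auto simp: free_gen_def)
    also have "\<dots> = \<phi> x" using \<phi>[OF that] by (simp add: free_gen_def)
    finally show ?thesis .
  qed
  ultimately show ?thesis by blast
qed

end

section \<open>Tensor products\<close>

locale module_pair =
  fixes R :: "'r ring" (structure) and M :: "('r, 'a) module" and N :: "('r, 'b) module"
  assumes module_M: "module R M" and module_N: "module R N"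
begin

abbreviation "Free \<equiv> free_module R (carrier M \<times> carrier N)"
abbreviation "Null \<equiv> tensor_null R M N"
abbreviation "MN \<equiv> tensor R M N"

lemma cring_R: "cring R" by (rule module.axioms(1)[OF module_M])

lemma module_Free: "module R Free" by (rule module_free[OF cring_R])

lemma gen_closed: "\<lbrakk>x \<in> carrier M; y \<in> carrier N\<rbrakk> \<Longrightarrow> free_gen R (x, y) \<in> carrier Free"
  by (rule free_gen_closed[OF cring_R]) simp

lemma tensor_relations_closed: "tensor_relations R M N \<subseteq> carrier Free"
proof -
  interpret M: module R M by (rule module_M)
  interpret N: module R N by (rule module_N)
  interpret F: module R Free by (rule module_Free)
  show ?thesis
    by (auto simp: tensor_relations_def Let_def intro!: F.minus_closed F.add.m_closed F.smult_closed gen_closed)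
qed

lemma null_quotient: "module_quotient R Free Null"
  unfolding tensor_null_def
  by (intro module_quotient.intro module_quotient_axioms.intro module_Free
      submodule_generated(1) tensor_relations_closed)

lemma module_tensor: "module R MN"
  unfolding tensor_def by (rule module_quotient.module_quotient_module[OF null_quotient])

lemma relation_in_null: "r \<in> tensor_relations R M N \<Longrightarrow> r \<in> Null"
  unfolding tensor_null_def using submodule_generated(2)[OF module_Free tensor_relations_closed] by blast

lemma pure_tensor_closed: "\<lbrakk>x \<in> carrier M; y \<in> carrier N\<rbrakk> \<Longrightarrow> pure_tensor R M N x y \<in> carrier MN"
  unfolding tensor_def pure_tensor_def module_quotient.carrier_quotient[OF null_quotient]
  using gen_closed by blast

lemma pure_tensor_add_left:
  assumes "x \<in> carrier M" "x' \<in> carrier M" "y \<in> carrier N"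
  shows "pure_tensor R M N (x \<oplus>\<^bsub>M\<^esub> x') y = pure_tensor R M N x y \<oplus>\<^bsub>MN\<^esub> pure_tensor R M N x' y"
proof -
  interpret M: module R M by (rule module_M)
  interpret F: module R Free by (rule module_Free)
  have "free_gen R (x \<oplus>\<^bsub>M\<^esub> x', y) \<ominus>\<^bsub>Free\<^esub> (free_gen R (x, y) \<oplus>\<^bsub>Free\<^esub> free_gen R (x', y)) \<in> Null"
    using assms by (intro relation_in_null) (unfold tensor_relations_def Let_def, blast)
  then show ?thesis using assms unfolding tensor_def pure_tensor_def
    by (simp add: module_quotient.add_quotient[OF null_quotient] module_quotient.coset_eq_iff[OF null_quotient] gen_closed)
qed

lemma pure_tensor_add_right:
  assumes "x \<in> carrier M" "y \<in> carrier N" "y' \<in> carrier N"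
  shows "pure_tensor R M N x (y \<oplus>\<^bsub>N\<^esub> y') = pure_tensor R M N x y \<oplus>\<^bsub>MN\<^esub> pure_tensor R M N x y'"
proof -
  interpret N: module R N by (rule module_N)
  interpret F: module R Free by (rule module_Free)
  have "free_gen R (x, y \<oplus>\<^bsub>N\<^esub> y') \<ominus>\<^bsub>Free\<^esub> (free_gen R (x, y) \<oplus>\<^bsub>Free\<^esub> free_gen R (x, y')) \<in> Null"
    using assms by (intro relation_in_null) (unfold tensor_relations_def Let_def, blast)
  then show ?thesis using assms unfolding tensor_def pure_tensor_def
    by (simp add: module_quotient.add_quotient[OF null_quotient] module_quotient.coset_eq_iff[OF null_quotient] gen_closed)
qed

lemma pure_tensor_smult_left:
  assumes "a \<in> carrier R" "x \<in> carrier M" "y \<in> carrier N"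
  shows "pure_tensor R M N (a \<odot>\<^bsub>M\<^esub> x) y = a \<odot>\<^bsub>MN\<^esub> pure_tensor R M N x y"
proof -
  interpret M: module R M by (rule module_M)
  interpret F: module R Free by (rule module_Free)
  have "free_gen R (a \<odot>\<^bsub>M\<^esub> x, y) \<ominus>\<^bsub>Free\<^esub> (a \<odot>\<^bsub>Free\<^esub> free_gen R (x, y)) \<in> Null"
    using assms by (intro relation_in_null) (unfold tensor_relations_def Let_def, blast)
  then show ?thesis using assms unfolding tensor_def pure_tensor_def
    by (simp add: module_quotient.smult_quotient[OF null_quotient] module_quotient.coset_eq_iff[OF null_quotient] gen_closed)
qed

lemma pure_tensor_smult_right:
  assumes "a \<in> carrier R" "x \<in> carrier M" "y \<in> carrier N"
  shows "pure_tensor R M N x (a \<odot>\<^bsub>N\<^esub> y) = a \<odot>\<^bsub>MN\<^esub> pure_tensor R M N x y"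
proof -
  interpret N: module R N by (rule module_N)
  interpret F: module R Free by (rule module_Free)
  have "free_gen R (x, a \<odot>\<^bsub>N\<^esub> y) \<ominus>\<^bsub>Free\<^esub> (a \<odot>\<^bsub>Free\<^esub> free_gen R (x, y)) \<in> Null"
    using assms by (intro relation_in_null) (unfold tensor_relations_def Let_def, blast)
  then show ?thesis using assms unfolding tensor_def pure_tensor_def
    by (simp add: module_quotient.smult_quotient[OF null_quotient] module_quotient.coset_eq_iff[OF null_quotient] gen_closed)
qed

text \<open>Sums of pure tensors suffice without coefficients, since a scalar can be moved into the
  left factor.\<close>

lemma tensor_induct:
  assumes z: "z \<in> carrier MN" and zero: "P \<zero>\<^bsub>MN\<^esub>"
    and step: "\<And>z x y. \<lbrakk>z \<in> carrier MN; x \<in> carrier M; y \<in> carrier N; P z\<rbrakk> \<Longrightarrow> P (z \<oplus>\<^bsub>MN\<^esub> pure_tensor R M N x y)"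
  shows "P z"
proof -
  interpret M: module R M by (rule module_M)
  interpret F: module R Free by (rule module_Free)
  note q = module_quotient.carrier_quotient[OF null_quotient] module_quotient.zero_quotient[OF null_quotient]
    module_quotient.add_quotient[OF null_quotient] module_quotient.smult_quotient[OF null_quotient]
  have "P (Null +>\<^bsub>Free\<^esub> f)" if "f \<in> carrier Free" for f
    using that
  proof (rule free_induct[OF cring_R])
    show "P (Null +>\<^bsub>Free\<^esub> \<zero>\<^bsub>Free\<^esub>)"
      using zero unfolding tensor_def q(2) .
  next
    fix f a p assume f: "f \<in> carrier Free" and a: "a \<in> carrier R" and "p \<in> carrier M \<times> carrier N" and P: "P (Null +>\<^bsub>Free\<^esub> f)"
    then obtain x y where p: "p = (x, y)" "x \<in> carrier M" "y \<in> carrier N" by blast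
    have "Null +>\<^bsub>Free\<^esub> (f \<oplus>\<^bsub>Free\<^esub> a \<odot>\<^bsub>Free\<^esub> free_gen R p) =
        (Null +>\<^bsub>Free\<^esub> f) \<oplus>\<^bsub>MN\<^esub> (a \<odot>\<^bsub>MN\<^esub> pure_tensor R M N x y)"
      using f a p unfolding tensor_def pure_tensor_def by (simp add: q(3,4) gen_closed)
    also have "\<dots> = (Null +>\<^bsub>Free\<^esub> f) \<oplus>\<^bsub>MN\<^esub> pure_tensor R M N (a \<odot>\<^bsub>M\<^esub> x) y"
      using a p by (simp add: pure_tensor_smult_left)
    also have "P \<dots>" using f a p P
      by (intro step) (auto simp: tensor_def q(1))
    finally show "P (Null +>\<^bsub>Free\<^esub> (f \<oplus>\<^bsub>Free\<^esub> a \<odot>\<^bsub>Free\<^esub> free_gen R p))" .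
  qed
  then show ?thesis using z unfolding tensor_def q(1) by blast
qed

lemma tensor_hom_eqI:
  assumes K: "module R K" and h: "h \<in> module_hom R MN K" and h': "h' \<in> module_hom R MN K"
    and eq: "\<And>x y. \<lbrakk>x \<in> carrier M; y \<in> carrier N\<rbrakk> \<Longrightarrow> h (pure_tensor R M N x y) = h' (pure_tensor R M N x y)"
    and z: "z \<in> carrier MN"
  shows "h z = h' z"
  using z
proof (rule tensor_induct)
  show "h \<zero>\<^bsub>MN\<^esub> = h' \<zero>\<^bsub>MN\<^esub>"
    by (simp only: module_hom_zero[OF module_tensor K h] module_hom_zero[OF module_tensor K h'])
  show "h (z \<oplus>\<^bsub>MN\<^esub> pure_tensor R M N x y) = h' (z \<oplus>\<^bsub>MN\<^esub> pure_tensor R M N x y)"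
    if "z \<in> carrier MN" "x \<in> carrier M" "y \<in> carrier N" "h z = h' z" for z x y
    using that by (simp add: module_homD(2)[OF h] module_homD(2)[OF h'] pure_tensor_closed eq)
qed

text \<open>The map \<open>\<beta>\<close> is extended linearly from the generators of the free
  module. Each of the four assumptions on \<open>\<beta>\<close> kills one of the four families of
  relations.\<close>

lemma tensor_lift:
  assumes K: "module R K"
    and closed: "\<And>x y. \<lbrakk>x \<in> carrier M; y \<in> carrier N\<rbrakk> \<Longrightarrow> \<beta> x y \<in> carrier K"
    and add_left: "\<And>x x' y. \<lbrakk>x \<in> carrier M; x' \<in> carrier M; y \<in> carrier N\<rbrakk> \<Longrightarrow> \<beta> (x \<oplus>\<^bsub>M\<^esub> x') y = \<beta> x y \<oplus>\<^bsub>K\<^esub> \<beta> x' y"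
    and add_right: "\<And>x y y'. \<lbrakk>x \<in> carrier M; y \<in> carrier N; y' \<in> carrier N\<rbrakk> \<Longrightarrow> \<beta> x (y \<oplus>\<^bsub>N\<^esub> y') = \<beta> x y \<oplus>\<^bsub>K\<^esub> \<beta> x y'"
    and smult_left: "\<And>a x y. \<lbrakk>a \<in> carrier R; x \<in> carrier M; y \<in> carrier N\<rbrakk> \<Longrightarrow> \<beta> (a \<odot>\<^bsub>M\<^esub> x) y = a \<odot>\<^bsub>K\<^esub> \<beta> x y"
    and smult_right: "\<And>a x y. \<lbrakk>a \<in> carrier R; x \<in> carrier M; y \<in> carrier N\<rbrakk> \<Longrightarrow> \<beta> x (a \<odot>\<^bsub>N\<^esub> y) = a \<odot>\<^bsub>K\<^esub> \<beta> x y"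
  shows "\<exists>h\<in>module_hom R MN K. \<forall>x\<in>carrier M. \<forall>y\<in>carrier N. h (pure_tensor R M N x y) = \<beta> x y"
proof -
  interpret M: module R M by (rule module_M)
  interpret N: module R N by (rule module_N)
  interpret F: module R Free by (rule module_Free)
  interpret K: module R K by (rule K)
  obtain f where f: "f \<in> module_hom R Free K"
    and f_gen': "\<forall>p\<in>carrier M \<times> carrier N. f (free_gen R p) = (case p of (x, y) \<Rightarrow> \<beta> x y)"
    using free_lift[OF cring_R K, of "carrier M \<times> carrier N" "\<lambda>(x, y). \<beta> x y"] closed by auto
  then have f_gen: "f (free_gen R (x, y)) = \<beta> x y" if "x \<in> carrier M" "y \<in> carrier N" for x y
    using that by simp
  note hom = module_homD[OF f] module_hom_minus[OF module_Free K f]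
  have "f r = \<zero>\<^bsub>K\<^esub>" if "r \<in> tensor_relations R M N" for r
    using that unfolding tensor_relations_def Let_def
    by (elim UnE CollectE exE conjE; hypsubst)
      (simp_all add: hom gen_closed f_gen closed add_left add_right smult_left smult_right K.minus_eq_zero_iff)
  then have "tensor_relations R M N \<subseteq> hom_kernel Free K f"
    using tensor_relations_closed unfolding hom_kernel_def by blast
  then have "Null \<subseteq> hom_kernel Free K f" unfolding tensor_null_def
    by (rule generated_submodule_minimal[OF submodule_kernel[OF module_Free K f]])
  then have "f x = \<zero>\<^bsub>K\<^esub>" if "x \<in> Null" for x using that by (auto simp: hom_kernel_def)
  from module_quotient.quotient_lift[OF null_quotient K f this]
  obtain h where h: "h \<in> module_hom R MN K" "\<forall>z\<in>carrier Free. h (Null +>\<^bsub>Free\<^esub> z) = f z"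
    unfolding tensor_def by blast
  then have "\<forall>x\<in>carrier M. \<forall>y\<in>carrier N. h (pure_tensor R M N x y) = \<beta> x y"
    by (simp add: pure_tensor_def gen_closed f_gen)
  with h(1) show ?thesis by blast
qed

end

text \<open>This justifies the definite description. Existence is the universal property followed by
  restriction to the carrier; uniqueness holds because pure tensors determine a homomorphism and
  extensionality fixes the values elsewhere.\<close>

lemma tensor_map:
  assumes M: "module R M" and M': "module R M'" and N: "module R N" and f: "f \<in> module_hom R M M'"
  shows "tensor_map R M M' N f \<in> module_hom R (tensor R M N) (tensor R M' N)"
    and "\<lbrakk>x \<in> carrier M; y \<in> carrier N\<rbrakk> \<Longrightarrow>
      tensor_map R M M' N f (pure_tensor R M N x y) = pure_tensor R M' N (f x) y"
proof -
  have P: "module_pair R M N" and P': "module_pair R M' N"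
    using M M' N by (simp_all add: module_pair_def)
  note T' = module_pair.module_tensor[OF P']
  let ?spec = "\<lambda>h. h \<in> module_hom R (tensor R M N) (tensor R M' N) \<and> h \<in> extensional (carrier (tensor R M N)) \<and>
     (\<forall>x\<in>carrier M. \<forall>y\<in>carrier N. h (pure_tensor R M N x y) = pure_tensor R M' N (f x) y)"
  interpret T: module R "tensor R M N" by (rule module_pair.module_tensor[OF P])
  have "\<exists>h\<in>module_hom R (tensor R M N) (tensor R M' N).
      \<forall>x\<in>carrier M. \<forall>y\<in>carrier N. h (pure_tensor R M N x y) = pure_tensor R M' N (f x) y"
    using module_homD[OF f]
    by (intro module_pair.tensor_lift[OF P T'])
      (simp_all add: module_pair.pure_tensor_closed[OF P'] module_pair.pure_tensor_add_left[OF P']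
        module_pair.pure_tensor_add_right[OF P'] module_pair.pure_tensor_smult_left[OF P']
        module_pair.pure_tensor_smult_right[OF P'])
  then obtain h where h: "h \<in> module_hom R (tensor R M N) (tensor R M' N)"
      "\<forall>x\<in>carrier M. \<forall>y\<in>carrier N. h (pure_tensor R M N x y) = pure_tensor R M' N (f x) y" by blast
  let ?h = "restrict h (carrier (tensor R M N))"
  have "?h \<in> module_hom R (tensor R M N) (tensor R M' N)"
    using module_homD[OF h(1)] by (intro module_homI) simp_all
  then have ex: "?spec ?h" using h(2) by (simp add: module_pair.pure_tensor_closed[OF P])
  have unique: "k = ?h" if k: "?spec k" for k
  proof (rule extensionalityI)
    show "k z = ?h z" if "z \<in> carrier (tensor R M N)" for z
    proof (rule module_pair.tensor_hom_eqI[OF P T' _ _ _ that])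
      show "k (pure_tensor R M N x y) = ?h (pure_tensor R M N x y)" if "x \<in> carrier M" "y \<in> carrier N" for x y
        using k ex that by simp
    qed (use k ex in blast)+
  qed (use k ex in blast)+
  have "?spec (tensor_map R M M' N f)"
    unfolding tensor_map_def using ex unique by (rule theI)
  then show "tensor_map R M M' N f \<in> module_hom R (tensor R M N) (tensor R M' N)"
    "\<lbrakk>x \<in> carrier M; y \<in> carrier N\<rbrakk> \<Longrightarrow>
      tensor_map R M M' N f (pure_tensor R M N x y) = pure_tensor R M' N (f x) y"
    by blast+
qed

section \<open>Tor in degree zero\<close>

lemma regular_module_simps [simp]:
  "carrier (regular_module R) = carrier R" "zero (regular_module R) = zero R"
  "add (regular_module R) = add R" "smult (regular_module R) = mult R"
  "a_inv (regular_module R) = a_inv R"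
  by (simp_all add: regular_module_def a_inv_def m_inv_def fun_eq_iff)

lemma minus_regular_module [simp]: "a_minus (regular_module R) = a_minus R"
  by (intro ext) (simp add: a_minus_def)

lemma ideal_module_quotient:
  assumes "cring R" "ideal I R"
  shows "module_quotient R (regular_module R) I"
proof -
  interpret R: cring R by fact
  interpret I: ideal I R by fact
  have mod: "module R (regular_module R)"
  proof (rule moduleI)
    show "abelian_group (regular_module R)"
      by (rule abelian_groupI) (auto simp: R.a_ac intro!: bexI[of _ "a_inv R _"] R.l_neg)
  qed (simp_all add: R.is_cring R.l_distr R.r_distr R.m_assoc)
  interpret module R "regular_module R" by (rule mod)
  have "submodule I R (regular_module R)"
    by (rule submoduleI) (auto simp: I.I_l_closed)
  then show ?thesis by (intro module_quotient.intro module_quotient_axioms.intro mod)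
qed

lemma
  fixes R :: "'r ring" (structure)
  assumes cring: "cring R" and I: "ideal I R" and J: "ideal J R"
    and res: "projective_resolution R P d \<epsilon> (ring_mod_ideal R I)"
  shows module_Tor_0: "module R (Tor R P d (ring_mod_ideal R J) 0)"
    and Tor_0_isomorphic: "module_isomorphic R (Tor R P d (ring_mod_ideal R J) 0) (ring_mod_ideal R (I <+>\<^bsub>R\<^esub> J))"
proof -
  define K where "K = I <+>\<^bsub>R\<^esub> J"
  define N where "N = ring_mod_ideal R J"
  define cs where "cs H a = H +>\<^bsub>regular_module R\<^esub> a" for H a
  interpret R: cring R by (rule cring)
  interpret I: ideal I R by (rule I)
  interpret J: ideal J R by (rule J)
  have idealK: "ideal K R" unfolding K_def by (rule R.add_ideals[OF I J])
  interpret K: ideal K R by (rule idealK)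
  have sum_K: "i \<oplus> j \<in> K" if "i \<in> I" "j \<in> J" for i j
    using that by (auto simp: K_def set_add_def')
  have quot: "module_quotient R (regular_module R) H" if "ideal H R" for H
    by (rule ideal_module_quotient[OF cring that])
  have carrier: "carrier (ring_mod_ideal R H) = cs H ` carrier R"
    and zero: "\<zero>\<^bsub>ring_mod_ideal R H\<^esub> = cs H \<zero>"
    and add: "\<And>a b. \<lbrakk>a \<in> carrier R; b \<in> carrier R\<rbrakk> \<Longrightarrow> cs H a \<oplus>\<^bsub>ring_mod_ideal R H\<^esub> cs H b = cs H (a \<oplus> b)"
    and smult: "\<And>a b. \<lbrakk>a \<in> carrier R; b \<in> carrier R\<rbrakk> \<Longrightarrow> a \<odot>\<^bsub>ring_mod_ideal R H\<^esub> cs H b = cs H (a \<otimes> b)"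
    and cs_eq_iff: "\<And>a b. \<lbrakk>a \<in> carrier R; b \<in> carrier R\<rbrakk> \<Longrightarrow> cs H a = cs H b \<longleftrightarrow> a \<ominus> b \<in> H"
    and mod: "module R (ring_mod_ideal R H)"
    if "ideal H R" for H
    using module_quotient.carrier_quotient[OF quot[OF that]] module_quotient.zero_quotient[OF quot[OF that]]
      module_quotient.add_quotient[OF quot[OF that]] module_quotient.smult_quotient[OF quot[OF that]]
      module_quotient.coset_eq_iff[OF quot[OF that]] module_quotient.module_quotient_module[OF quot[OF that]]
    by (simp_all add: cs_def)
  have cs_mem: "a' \<in> carrier R \<and> a' \<ominus> a \<in> H" if "ideal H R" "a \<in> carrier R" "a' \<in> cs H a" for H a a'
  proof -
    interpret H: ideal H R by (rule that(1))
    show ?thesis using that(2,3) by (auto simp: cs_def a_r_coset_def' R.a_assoc a_minus_def R.r_neg)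
  qed
  have cs_self: "a \<in> cs H a" if "ideal H R" "a \<in> carrier R" for H a
  proof -
    interpret H: ideal H R by (rule that(1))
    have "\<zero> \<oplus> a \<in> cs H a" using H.zero_closed by (auto simp: cs_def a_r_coset_def')
    then show ?thesis using that(2) by simp
  qed

  have P0: "module R (P 0)" and P1: "module R (P (Suc 0))"
    and \<epsilon>: "\<epsilon> \<in> module_hom R (P 0) (ring_mod_ideal R I)" and \<epsilon>_surj: "\<epsilon> ` carrier (P 0) = carrier (ring_mod_ideal R I)"
    and d: "d 0 \<in> module_hom R (P (Suc 0)) (P 0)"
    and exact: "d 0 ` carrier (P (Suc 0)) = hom_kernel (P 0) (ring_mod_ideal R I) \<epsilon>"
    using res by (simp_all add: projective_resolution_def projective_module_def)
  have N: "module R N" unfolding N_def by (rule mod[OF J])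
  have pair: "module_pair R (P 0) N" and pair1: "module_pair R (P (Suc 0)) N"
    using P0 P1 N by (simp_all add: module_pair_def)
  interpret P0: module R "P 0" by (rule P0)
  interpret N: module R N by (rule N)
  define T where "T = tensor R (P 0) N"
  define pt where "pt = pure_tensor R (P 0) N"
  have modT: "module R T" unfolding T_def by (rule module_pair.module_tensor[OF pair])
  interpret T: module R T by (rule modT)
  note pt = module_pair.pure_tensor_closed[OF pair, folded pt_def T_def]
    module_pair.pure_tensor_add_left[OF pair, folded pt_def T_def]
    module_pair.pure_tensor_smult_left[OF pair, folded pt_def T_def]
    module_pair.pure_tensor_smult_right[OF pair, folded pt_def T_def]
  note NJ = carrier[OF J, folded N_def] zero[OF J, folded N_def] add[OF J, folded N_def] smult[OF J, folded N_def]
  define u where "u = cs J \<one>"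
  have u: "u \<in> carrier N" by (simp add: u_def NJ)
  have N_cyclic: "cs J b = b \<odot>\<^bsub>N\<^esub> u" if "b \<in> carrier R" for b
    using that by (simp add: u_def NJ)

  \<comment> \<open>The union runs over all representatives of both cosets. All of them give the
    same coset modulo \<open>K\<close>, so the union is that coset and no representative has to be
    chosen.\<close>
  define \<beta> where "\<beta> p y = (\<Union>a\<in>\<epsilon> p. \<Union>b\<in>y. cs K (a \<otimes> b))" for p y
  have \<beta>: "\<beta> p (cs J b) = cs K (a \<otimes> b)" if a: "a \<in> carrier R" and b: "b \<in> carrier R" and p: "\<epsilon> p = cs I a" for a b p
  proof -
    have "cs K (a' \<otimes> b') = cs K (a \<otimes> b)" if a': "a' \<in> cs I a" and b': "b' \<in> cs J b" for a' b'
    proof -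
      have *: "a' \<in> carrier R" "a' \<ominus> a \<in> I" "b' \<in> carrier R" "b' \<ominus> b \<in> J"
        using cs_mem[OF I a a'] cs_mem[OF J b b'] by auto
      then have "(a' \<ominus> a) \<otimes> b' \<oplus> a \<otimes> (b' \<ominus> b) \<in> K"
        using a by (intro sum_K I.I_r_closed J.I_l_closed)
      also have "(a' \<ominus> a) \<otimes> b' \<oplus> a \<otimes> (b' \<ominus> b) = a' \<otimes> b' \<ominus> a \<otimes> b"
        using a b * by (simp add: a_minus_def R.l_distr R.r_distr R.l_minus R.r_minus R.a_assoc R.r_neg1)
      finally show ?thesis using a b * by (simp add: cs_eq_iff[OF idealK])
    qed
    then have "\<beta> p (cs J b) = (\<Union>a'\<in>cs I a. \<Union>b'\<in>cs J b. cs K (a \<otimes> b))"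
      unfolding \<beta>_def p by (intro SUP_cong refl)
    then show ?thesis using cs_self[OF I a] cs_self[OF J b] by blast
  qed
  have \<epsilon>_rep: "\<exists>a\<in>carrier R. \<epsilon> p = cs I a" if "p \<in> carrier (P 0)" for p
    using module_homD(1)[OF \<epsilon> that] by (auto simp: carrier[OF I])
  have N_rep: "\<exists>b\<in>carrier R. y = cs J b" if "y \<in> carrier N" for y
    using that by (auto simp: NJ)
  note \<epsilon>_hom = module_homD(2,3)[OF \<epsilon>]
  note KK = carrier[OF idealK] zero[OF idealK] add[OF idealK] smult[OF idealK]
  have "\<exists>h\<in>module_hom R T (ring_mod_ideal R K). \<forall>p\<in>carrier (P 0). \<forall>y\<in>carrier N. h (pt p y) = \<beta> p y"
    unfolding T_def pt_def
  proof (rule module_pair.tensor_lift[OF pair mod[OF idealK]])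
    fix p y assume p: "p \<in> carrier (P 0)" and y: "y \<in> carrier N"
    obtain a b where a: "a \<in> carrier R" "\<epsilon> p = cs I a" and b: "b \<in> carrier R" "y = cs J b"
      using \<epsilon>_rep[OF p] N_rep[OF y] by blast
    have ab: "\<beta> p y = cs K (a \<otimes> b)" unfolding b(2) by (rule \<beta>[OF a(1) b(1) a(2)])
    show "\<beta> p y \<in> carrier (ring_mod_ideal R K)"
      using a(1) b(1) by (simp add: ab KK)
    show "\<beta> (p \<oplus>\<^bsub>P 0\<^esub> p') y = \<beta> p y \<oplus>\<^bsub>ring_mod_ideal R K\<^esub> \<beta> p' y" if p': "p' \<in> carrier (P 0)" for p'
    proof -
      obtain a' where a': "a' \<in> carrier R" "\<epsilon> p' = cs I a'" using \<epsilon>_rep[OF p'] by blast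
      have "\<epsilon> (p \<oplus>\<^bsub>P 0\<^esub> p') = cs I (a \<oplus> a')"
        using p p' a a' by (simp add: \<epsilon>_hom add[OF I])
      then show ?thesis
        using \<beta>[of "a \<oplus> a'" b "p \<oplus>\<^bsub>P 0\<^esub> p'"] \<beta>[OF a'(1) b(1) a'(2)] ab a(1) a'(1) b
        by (simp add: KK R.l_distr)
    qed
    show "\<beta> p (y \<oplus>\<^bsub>N\<^esub> y') = \<beta> p y \<oplus>\<^bsub>ring_mod_ideal R K\<^esub> \<beta> p y'" if y': "y' \<in> carrier N" for y'
    proof -
      obtain b' where b': "b' \<in> carrier R" "y' = cs J b'" using N_rep[OF y'] by blast
      then show ?thesis
        using \<beta>[OF a(1) _ a(2), of b'] \<beta>[OF a(1) _ a(2), of "b \<oplus> b'"] ab a(1) b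
        by (simp add: KK NJ R.r_distr)
    qed
    fix c assume c: "c \<in> carrier R"
    have "\<epsilon> (c \<odot>\<^bsub>P 0\<^esub> p) = cs I (c \<otimes> a)"
      using p a c by (simp add: \<epsilon>_hom smult[OF I])
    then show "\<beta> (c \<odot>\<^bsub>P 0\<^esub> p) y = c \<odot>\<^bsub>ring_mod_ideal R K\<^esub> \<beta> p y"
      using \<beta>[of "c \<otimes> a" b "c \<odot>\<^bsub>P 0\<^esub> p"] ab a(1) b c by (simp add: KK R.m_assoc)
    show "\<beta> p (c \<odot>\<^bsub>N\<^esub> y) = c \<odot>\<^bsub>ring_mod_ideal R K\<^esub> \<beta> p y"
      using \<beta>[OF a(1) _ a(2), of "c \<otimes> b"] ab a(1) b c by (simp add: KK NJ R.m_lcomm)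
  qed
  then obtain h where h: "h \<in> module_hom R T (ring_mod_ideal R K)"
    and h_pt: "\<And>p y. \<lbrakk>p \<in> carrier (P 0); y \<in> carrier N\<rbrakk> \<Longrightarrow> h (pt p y) = \<beta> p y" by blast

  \<comment> \<open>A lift of the unit coset: its multiples reach every coset, which gives
    surjectivity, and in the kernel computation it absorbs the part of a representative lying in
    \<open>J\<close>.\<close>
  obtain q where q: "q \<in> carrier (P 0)" "\<epsilon> q = cs I \<one>"
    using \<epsilon>_surj R.one_closed unfolding carrier[OF I] by (metis (no_types, lifting) imageE imageI)
  have \<epsilon>_q: "\<epsilon> (a \<odot>\<^bsub>P 0\<^esub> q) = cs I a" if "a \<in> carrier R" for a
    using that q by (simp add: \<epsilon>_hom smult[OF I])
  have h_u: "h (pt p u) = cs K a" if "p \<in> carrier (P 0)" "a \<in> carrier R" "\<epsilon> p = cs I a" for p a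
    using that \<beta>[of a \<one> p] by (simp add: h_pt[OF _ u]) (simp add: u_def)
  have surj: "h ` carrier T = carrier (ring_mod_ideal R K)"
  proof
    show "h ` carrier T \<subseteq> carrier (ring_mod_ideal R K)" using module_homD(1)[OF h] by blast
    show "carrier (ring_mod_ideal R K) \<subseteq> h ` carrier T"
    proof
      fix X assume "X \<in> carrier (ring_mod_ideal R K)"
      then obtain a where a: "a \<in> carrier R" "X = cs K a" by (auto simp: KK)
      then have "X = h (pt (a \<odot>\<^bsub>P 0\<^esub> q) u)" using q by (simp add: h_u \<epsilon>_q)
      then show "X \<in> h ` carrier T" using a q u by (auto simp: pt)
    qed
  qed
  have pt_zero: "pt p \<zero>\<^bsub>N\<^esub> = \<zero>\<^bsub>T\<^esub>" if "p \<in> carrier (P 0)" for p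
    using pt(4)[of \<zero> p u] pt(1)[of p u] that u by simp
  \<comment> \<open>Writing \<open>y\<close> as \<open>b\<close> times \<open>u\<close> moves
    \<open>b\<close> to the left factor, and pure tensors with the same right factor
    \<open>u\<close> add on the left.\<close>
  have pure: "\<exists>p\<in>carrier (P 0). z = pt p u" if "z \<in> carrier T" for z
    using that unfolding T_def
  proof (rule module_pair.tensor_induct[OF pair])
    have "pt \<zero>\<^bsub>P 0\<^esub> u = \<zero>\<^bsub>T\<^esub>"
      using pt(3)[of \<zero> "\<zero>\<^bsub>P 0\<^esub>" u] pt(1)[of "\<zero>\<^bsub>P 0\<^esub>" u] u by simp
    then show "\<exists>p\<in>carrier (P 0). \<zero>\<^bsub>tensor R (P 0) N\<^esub> = pt p u" unfolding T_def by (metis P0.M.zero_closed)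
  next
    fix z p y assume p: "p \<in> carrier (P 0)" and y: "y \<in> carrier N" and "\<exists>p\<in>carrier (P 0). z = pt p u"
    then obtain p' where p': "p' \<in> carrier (P 0)" "z = pt p' u" by blast
    obtain b where b: "b \<in> carrier R" "y = cs J b" using N_rep[OF y] by blast
    have "z \<oplus>\<^bsub>T\<^esub> pt p y = pt (p' \<oplus>\<^bsub>P 0\<^esub> b \<odot>\<^bsub>P 0\<^esub> p) u"
      using p p' b u by (simp add: N_cyclic pt)
    then show "\<exists>p''\<in>carrier (P 0). z \<oplus>\<^bsub>tensor R (P 0) N\<^esub> pure_tensor R (P 0) N p y = pt p'' u"
      using p p' b by (intro bexI[of _ "p' \<oplus>\<^bsub>P 0\<^esub> b \<odot>\<^bsub>P 0\<^esub> p"]) (simp_all add: T_def pt_def)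
  qed

  define tm where "tm = tensor_map R (P (Suc 0)) (P 0) N (d 0)"
  note tm = tensor_map[OF P1 P0 N d, folded tm_def T_def, folded pt_def]
  have "tm ` carrier (tensor R (P (Suc 0)) N) = hom_kernel T (ring_mod_ideal R K) h"
  proof (intro equalityI subsetI)
    fix z assume "z \<in> tm ` carrier (tensor R (P (Suc 0)) N)"
    then obtain w where w: "w \<in> carrier (tensor R (P (Suc 0)) N)" "z = tm w" by blast
    \<comment> \<open>Boundaries are shown to lie in the kernel by comparing the composite map with
      the zero map on pure tensors.\<close>
    have zero_hom: "(\<lambda>_. \<zero>\<^bsub>ring_mod_ideal R K\<^esub>) \<in> module_hom R (tensor R (P (Suc 0)) N) (ring_mod_ideal R K)"
      by (rule module_homI) (auto simp: KK)
    have "h (tm w) = \<zero>\<^bsub>ring_mod_ideal R K\<^esub>"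
    proof (rule module_pair.tensor_hom_eqI[OF pair1 mod[OF idealK] module_hom_comp[OF tm(1) h] zero_hom _ w(1)])
      fix x y assume x: "x \<in> carrier (P (Suc 0))" and y: "y \<in> carrier N"
      obtain b where b: "b \<in> carrier R" "y = cs J b" using N_rep[OF y] by blast
      have "d 0 x \<in> hom_kernel (P 0) (ring_mod_ideal R I) \<epsilon>" using exact x by blast
      then have "d 0 x \<in> carrier (P 0)" "\<epsilon> (d 0 x) = cs I \<zero>" by (simp_all add: hom_kernel_def zero[OF I])
      then show "h (tm (pure_tensor R (P (Suc 0)) N x y)) = \<zero>\<^bsub>ring_mod_ideal R K\<^esub>"
        using x y b \<beta>[of \<zero> b "d 0 x"] by (simp add: tm(2) h_pt KK)
    qed
    then show "z \<in> hom_kernel T (ring_mod_ideal R K) h"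
      using w module_homD(1)[OF tm(1)] by (simp add: hom_kernel_def)
  next
    fix z assume "z \<in> hom_kernel T (ring_mod_ideal R K) h"
    then have z: "z \<in> carrier T" "h z = cs K \<zero>" by (simp_all add: hom_kernel_def KK)
    obtain p where p: "p \<in> carrier (P 0)" "z = pt p u" using pure[OF z(1)] by blast
    obtain a where a: "a \<in> carrier R" "\<epsilon> p = cs I a" using \<epsilon>_rep[OF p(1)] by blast
    have "cs K a = cs K \<zero>" using z(2) p a by (simp add: h_u)
    then have "a \<in> K" using a by (simp add: cs_eq_iff[OF idealK] R.minus_zero_eq)
    \<comment> \<open>Subtracting \<open>j\<close> times \<open>q\<close> from \<open>p\<close>
      leaves an element with augmentation in \<open>I\<close>, hence zero, so by exactness it comes
      from \<open>d 0\<close>. The subtracted part contributes nothing: tensored with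
      \<open>u\<close> it equals \<open>q\<close> tensored with the coset of \<open>j\<close> modulo
      \<open>J\<close>, which is zero.\<close>
    then obtain i j where ij: "i \<in> I" "j \<in> J" "a = i \<oplus> j" by (auto simp: K_def set_add_def')
    then have carr: "i \<in> carrier R" "j \<in> carrier R" by (simp_all add: I.Icarr J.Icarr)
    have jq: "j \<odot>\<^bsub>P 0\<^esub> q \<in> carrier (P 0)" using carr q by simp
    have "a \<ominus> j = i" using ij carr by (simp add: a_minus_def R.a_assoc R.r_neg)
    then have "\<epsilon> p = \<epsilon> (j \<odot>\<^bsub>P 0\<^esub> q)" using a ij carr by (simp add: \<epsilon>_q cs_eq_iff[OF I])
    then have "\<epsilon> (p \<ominus>\<^bsub>P 0\<^esub> j \<odot>\<^bsub>P 0\<^esub> q) = \<zero>\<^bsub>ring_mod_ideal R I\<^esub>"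
      using p jq module_homD(1)[OF \<epsilon>] abelian_group.minus_eq_zero_iff[OF module.axioms(2)[OF mod[OF I]]]
      by (simp add: module_hom_minus[OF P0 mod[OF I] \<epsilon>])
    then have "p \<ominus>\<^bsub>P 0\<^esub> j \<odot>\<^bsub>P 0\<^esub> q \<in> d 0 ` carrier (P (Suc 0))"
      unfolding exact hom_kernel_def using p jq by (simp add: P0.M.minus_closed)
    then obtain x where x: "x \<in> carrier (P (Suc 0))" "p \<ominus>\<^bsub>P 0\<^esub> j \<odot>\<^bsub>P 0\<^esub> q = d 0 x" by blast
    have dx: "d 0 x \<in> carrier (P 0)" using module_homD(1)[OF d x(1)] .
    have "p = d 0 x \<oplus>\<^bsub>P 0\<^esub> j \<odot>\<^bsub>P 0\<^esub> q"
      using p jq unfolding x(2)[symmetric] by (simp add: a_minus_def P0.M.a_assoc P0.M.l_neg)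
    then have "z = pt (d 0 x) u \<oplus>\<^bsub>T\<^esub> pt (j \<odot>\<^bsub>P 0\<^esub> q) u" using p dx jq u by (simp add: pt)
    also have "pt (j \<odot>\<^bsub>P 0\<^esub> q) u = pt q (cs J j)" using carr q u by (simp add: pt N_cyclic)
    also have "cs J j = \<zero>\<^bsub>N\<^esub>" using ij carr by (simp add: NJ cs_eq_iff[OF J] R.minus_zero_eq)
    also have "pt q \<zero>\<^bsub>N\<^esub> = \<zero>\<^bsub>T\<^esub>" by (rule pt_zero[OF q(1)])
    finally have "z = tm (pure_tensor R (P (Suc 0)) N x u)" using dx u x by (simp add: tm(2) pt)
    then show "z \<in> tm ` carrier (tensor R (P (Suc 0)) N)"
      using module_pair.pure_tensor_closed[OF pair1 x(1) u] by blast
  qed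
  \<comment> \<open>In degree 0 every element is a cycle, so Tor is the quotient of the whole tensor
    product by the boundaries, which are now known to be the kernel of \<open>h\<close>.\<close>
  then have Tor: "Tor R P d N 0 = quotient_module T (hom_kernel T (ring_mod_ideal R K) h)"
    by (simp add: Tor_def Tor_cycles_def Tor_boundaries_def tm_def T_def)
  show "module R (Tor R P d (ring_mod_ideal R J) 0)"
    unfolding N_def[symmetric] Tor
    by (intro module_quotient.module_quotient_module module_quotient.intro module_quotient_axioms.intro
        modT submodule_kernel[OF modT mod[OF idealK] h])
  show "module_isomorphic R (Tor R P d (ring_mod_ideal R J) 0) (ring_mod_ideal R (I <+>\<^bsub>R\<^esub> J))"
    unfolding N_def[symmetric] K_def[symmetric] Tor by (rule first_isomorphism[OF modT mod[OF idealK] h surj])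
qed

theorem theorem1p5:
  fixes S :: braid_graph
    and P :: "nat \<Rightarrow> (plane set int_poly, 'p) module" and d :: "nat \<Rightarrow> 'p \<Rightarrow> 'p"
    and \<epsilon> :: "'p \<Rightarrow> plane set int_poly set"
    and P' :: "nat \<Rightarrow> (plane set int_poly, 'q) module" and d' :: "nat \<Rightarrow> 'q \<Rightarrow> 'q"
    and \<epsilon>' :: "'q \<Rightarrow> plane set int_poly set"
  assumes "partial_braid_graph S"
    and "connected (space_of S)"
  shows "((\<exists>e. exterior_edge S e) \<longrightarrow>
           projective_resolution (edge_ring S) P d \<epsilon> (ring_mod_ideal (edge_ring S) (L_ideal S)) \<longrightarrow>
           projective_resolution (edge_ring S) P' d' \<epsilon>' (ring_mod_ideal (edge_ring S) (L_ideal S)) \<longrightarrow>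
           module_isomorphic (edge_ring S)
             (Tor (edge_ring S) P d (ring_mod_ideal (edge_ring S) (N_ideal S)) 0)
             (Tor (edge_ring S) P' d' (ring_mod_ideal (edge_ring S) (Q_ideal S)) 0)) \<and>
         L_ideal S <+>\<^bsub>edge_ring S\<^esub> N_ideal S = L_ideal S <+>\<^bsub>edge_ring S\<^esub> Q_ideal S"
proof (intro conjI impI)
  note eq = L_plus_N_eq_L_plus_Q[OF assms(1)]
  show "L_ideal S <+>\<^bsub>edge_ring S\<^esub> N_ideal S = L_ideal S <+>\<^bsub>edge_ring S\<^esub> Q_ideal S" by (rule eq)
  assume res: "projective_resolution (edge_ring S) P d \<epsilon> (ring_mod_ideal (edge_ring S) (L_ideal S))"
    and res': "projective_resolution (edge_ring S) P' d' \<epsilon>' (ring_mod_ideal (edge_ring S) (L_ideal S))"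
  show "module_isomorphic (edge_ring S)
      (Tor (edge_ring S) P d (ring_mod_ideal (edge_ring S) (N_ideal S)) 0)
      (Tor (edge_ring S) P' d' (ring_mod_ideal (edge_ring S) (Q_ideal S)) 0)"
  proof (rule module_isomorphic_trans)
    show "module_isomorphic (edge_ring S)
        (Tor (edge_ring S) P d (ring_mod_ideal (edge_ring S) (N_ideal S)) 0)
        (ring_mod_ideal (edge_ring S) (L_ideal S <+>\<^bsub>edge_ring S\<^esub> Q_ideal S))"
      unfolding eq[symmetric] by (rule Tor_0_isomorphic[OF cring_edge_ring ideals_edge_ring(1,3) res])
    show "module_isomorphic (edge_ring S)
        (ring_mod_ideal (edge_ring S) (L_ideal S <+>\<^bsub>edge_ring S\<^esub> Q_ideal S))
        (Tor (edge_ring S) P' d' (ring_mod_ideal (edge_ring S) (Q_ideal S)) 0)"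
      by (rule module_isomorphic_sym[OF module_Tor_0 Tor_0_isomorphic];
          rule cring_edge_ring ideals_edge_ring res')
  qed
qed

end
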